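(* Let $r\in(0,1)$ and let $\varphi_r(z)=\frac{z+r}{1+rz}$ be the corresponding hyperbolic automorphism of the unit disc $\mathbb{D}$. Let $C_{\varphi_r}f=f\circ\varphi_r$ be the composition operator on $S^2(\mathbb{D})$ and $C_{\varphi_r}^*$ its Hilbert space adjoint. Then $C_{\varphi_r}^*-\overline{\lambda}I$ is universal on $S^2(\mathbb{D})$ for every $\lambda\in\mathcal{A}_r$, where \[ \mathcal{A}_r=\Big\{\lambda\in\mathbb{C}:\Big(\frac{1-r}{1+r}\Big)^{1/2}<|\lambda|<\Big(\frac{1-r}{1+r}\Big)^{-1/2}\Big\}. \]
   Context: $S^2(\mathbb{D})$ is the Hilbert space of analytic functions $f:\mathbb{D}\to\mathbb{C}$ with $f'$ in the Hardy space $H^2(\mathbb{D})$, normed by $\|f\|^2=|f(0)|^2+\|f'\|_{H^2}^2$ (equivalently, for $f=\sum a_nz^n$, a norm equivalent to $(\sum_n |a_n|^2(n+1)^2)^{1/2}$). $C_{\varphi_r}$ is bounded on $S^2(\mathbb{D})$. For a separable infinite-dimensional Hilbert space $H$, operators $T_1,T_2$ are similar if $T_1=J^{-1}T_2J$ for a linear isomorphism $J$; $U\in\mathcal{L}(H)$ is universal if for every $T\in\mathcal{L}(H)$ there exist a closed $U$-invariant subspace $M\subset H$ and $c\neq0$ such that $U|_M$ is similar to $cT$. *)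

theory Defs
  imports "HOL-Analysis.Analysis"
begin

text \<open>Elements of S^2(D) are represented as functions complex => complex that are
holomorphic on the unit disc and vanish outside it (so that each element of the
space has exactly one representative).\<close>

definition taylor_coeff :: "(complex \<Rightarrow> complex) \<Rightarrow> nat \<Rightarrow> complex" where
  "taylor_coeff g n = (deriv ^^ n) g 0 / of_nat (fact n)"

definition H2 :: "(complex \<Rightarrow> complex) set" where
  "H2 = {g. g holomorphic_on ball 0 1 \<and> summable (\<lambda>n. (cmod (taylor_coeff g n))\<^sup>2)}"

definition S2 :: "(complex \<Rightarrow> complex) set" where
  "S2 = {f. f holomorphic_on ball 0 1 \<and> (\<forall>z. z \<notin> ball 0 1 \<longrightarrow> f z = 0) \<and> deriv f \<in> H2}"

definition s2_inner :: "(complex \<Rightarrow> complex) \<Rightarrow> (complex \<Rightarrow> complex) \<Rightarrow> complex" where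
  "s2_inner f g = f 0 * cnj (g 0)
     + (\<Sum>n. taylor_coeff (deriv f) n * cnj (taylor_coeff (deriv g) n))"

definition s2_norm :: "(complex \<Rightarrow> complex) \<Rightarrow> real" where
  "s2_norm f = sqrt ((cmod (f 0))\<^sup>2 + (\<Sum>n. (cmod (taylor_coeff (deriv f) n))\<^sup>2))"

definition phi :: "real \<Rightarrow> complex \<Rightarrow> complex" where
  "phi r z = (z + complex_of_real r) / (1 + complex_of_real r * z)"

definition comp_op :: "real \<Rightarrow> (complex \<Rightarrow> complex) \<Rightarrow> (complex \<Rightarrow> complex)" where
  "comp_op r f = (\<lambda>z. if z \<in> ball 0 1 then f (phi r z) else 0)"

definition lin_on :: "(complex \<Rightarrow> complex) set \<Rightarrow> ((complex \<Rightarrow> complex) \<Rightarrow> (complex \<Rightarrow> complex)) \<Rightarrow> bool" where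
  "lin_on A T \<longleftrightarrow>
     (\<forall>f\<in>A. \<forall>g\<in>A. T (\<lambda>z. f z + g z) = (\<lambda>z. T f z + T g z)) \<and>
     (\<forall>c. \<forall>f\<in>A. T (\<lambda>z. c * f z) = (\<lambda>z. c * T f z))"

definition s2_bounded_op :: "((complex \<Rightarrow> complex) \<Rightarrow> (complex \<Rightarrow> complex)) \<Rightarrow> bool" where
  "s2_bounded_op T \<longleftrightarrow> (\<forall>f\<in>S2. T f \<in> S2) \<and> lin_on S2 T \<and>
     (\<exists>K. \<forall>f\<in>S2. s2_norm (T f) \<le> K * s2_norm f)"

definition s2_adjoint :: "((complex \<Rightarrow> complex) \<Rightarrow> (complex \<Rightarrow> complex)) \<Rightarrow> ((complex \<Rightarrow> complex) \<Rightarrow> (complex \<Rightarrow> complex))" where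
  "s2_adjoint A = (THE B. (\<forall>g. g \<notin> S2 \<longrightarrow> B g = (\<lambda>z. 0)) \<and> (\<forall>g\<in>S2. B g \<in> S2) \<and>
      (\<forall>f\<in>S2. \<forall>g\<in>S2. s2_inner (A f) g = s2_inner f (B g)))"

definition s2_closed_subspace :: "(complex \<Rightarrow> complex) set \<Rightarrow> bool" where
  "s2_closed_subspace M \<longleftrightarrow> M \<subseteq> S2 \<and> (\<lambda>z. 0) \<in> M \<and>
     (\<forall>f\<in>M. \<forall>g\<in>M. (\<lambda>z. f z + g z) \<in> M) \<and>
     (\<forall>c. \<forall>f\<in>M. (\<lambda>z. c * f z) \<in> M) \<and>
     (\<forall>F f. (\<forall>n. F n \<in> M) \<and> f \<in> S2 \<and> (\<lambda>n. s2_norm (\<lambda>z. F n z - f z)) \<longlonglongrightarrow> 0 \<longrightarrow> f \<in> M)"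

definition s2_similar_restr ::
  "((complex \<Rightarrow> complex) \<Rightarrow> (complex \<Rightarrow> complex)) \<Rightarrow> (complex \<Rightarrow> complex) set \<Rightarrow>
   ((complex \<Rightarrow> complex) \<Rightarrow> (complex \<Rightarrow> complex)) \<Rightarrow> bool" where
  "s2_similar_restr U M T \<longleftrightarrow> (\<exists>J. bij_betw J M S2 \<and> lin_on M J \<and>
     (\<exists>K. \<forall>m\<in>M. s2_norm (J m) \<le> K * s2_norm m) \<and>
     (\<exists>K. \<forall>m\<in>M. s2_norm m \<le> K * s2_norm (J m)) \<and>
     (\<forall>m\<in>M. J (U m) = T (J m)))"

definition s2_universal :: "((complex \<Rightarrow> complex) \<Rightarrow> (complex \<Rightarrow> complex)) \<Rightarrow> bool" where
  "s2_universal U \<longleftrightarrow> s2_bounded_op U \<and>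
     (\<forall>T. s2_bounded_op T \<longrightarrow>
       (\<exists>M c. s2_closed_subspace M \<and> (\<forall>m\<in>M. U m \<in> M) \<and> c \<noteq> 0 \<and>
              s2_similar_restr U M (\<lambda>f. (\<lambda>z. c * T f z))))"

end

theory Submission
  imports Defs "HOL-Complex_Analysis.Cauchy_Integral_Formula"
begin

text \<open>On derivatives, \<open>C\<^sub>\<phi>\<close> acts as the weighted composition operator
  \<open>W g = \<phi>' (g \<circ> \<phi>)\<close> on the Hardy space, and its adjoint restricts to the subspace f(0) = 0 as the
  adjoint of W. An indefinite quadratic form shows that \<open>W - \<lambda>\<close> is bounded below on the annulus.
  With x in (-1, 1) and \<open>K\<^sub>x\<close> the reproducing kernel, \<open>W\<^sup>* ((1 - x\<^sup>2) K\<^sub>x)\<close> is the same vector at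
  \<open>\<phi>(x)\<close>; so the sums of these vectors over the two-sided orbit of x, weighted by the powers of
  \<open>\<lambda>\<close>, converge and are eigenvectors. Different orbits give independent ones, so the kernel of
  \<open>(W - \<lambda>)\<^sup>*\<close> is infinite-dimensional, and universality follows from Caradus' criterion.\<close>

section \<open>The Hilbert space of square-summable sequences\<close>

text \<open>The composition operator keeps the constants but not the functions with f(0) = 0; its
  adjoint keeps these, the orthogonal complement of the constants, which is why the adjoint is the
  operator studied. With a = (1 - r)/(1 + r), the derivative of phi is a at the fixed point 1 and
  1/a at the fixed point -1. On the circle W multiplies squared mass near 1 by about a and near -1
  by about 1/a, and |lambda|^2 lies strictly between. The norm therefore sees one point where W is
  too small and one where it is too large compared with lambda. The form -Re <z g, g>, the integral
  of -cos(theta) |g|^2, is negative at 1 and positive at -1, so both gaps enter with positive sign.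
  The same two inequalities return as the convergence conditions at the two ends of an orbit.
  Boundary values and integrals occur only in this motivation: the proof works with inner products
  of coefficient sequences, and division by 1 + r z is the inverse of a perturbation of the identity
  of norm below 1.\<close>

lemma mult_cnj_cmod: "z * cnj z = (complex_of_real (cmod z))\<^sup>2" "cnj z * z = (complex_of_real (cmod z))\<^sup>2"
  using complex_norm_square[of z] by (simp_all add: mult.commute)

text \<open>\<open>S2\<close> is only a set of functions. A type of coefficient sequences can be
  made an instance of \<open>real_inner\<close> and \<open>banach\<close>, which gives access to the
  fixed point theorem, to \<open>blinfun\<close> and to series; the complex structure is carried
  separately by \<open>cscale\<close> and \<open>cinner\<close>.\<close>

typedef l2 = "{x :: nat \<Rightarrow> complex. summable (\<lambda>n. (cmod (x n))\<^sup>2)}"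
  morphisms coord Abs_l2
  by (rule exI[of _ "\<lambda>_. 0"]) simp

lemma l2_eqI: "(\<And>n. coord x n = coord y n) \<Longrightarrow> x = y"
  by (metis coord_inject ext)

lemma summable_coord_sq: "summable (\<lambda>n. (cmod (coord x n))\<^sup>2)"
  using coord[of x] by simp

lemma coord_Abs_l2: "summable (\<lambda>n. (cmod (f n))\<^sup>2) \<Longrightarrow> coord (Abs_l2 f) n = f n"
  by (simp add: Abs_l2_inverse)

lemma summable_add_sq:
  fixes f g :: "nat \<Rightarrow> complex"
  assumes "summable (\<lambda>n. (cmod (f n))\<^sup>2)" "summable (\<lambda>n. (cmod (g n))\<^sup>2)"
  shows "summable (\<lambda>n. (cmod (f n + g n))\<^sup>2)"
proof (rule summable_comparison_test')
  show "summable (\<lambda>n. 2 * (cmod (f n))\<^sup>2 + 2 * (cmod (g n))\<^sup>2)"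
    using assms by (intro summable_add summable_mult)
  fix n :: nat
  have "(cmod (f n + g n))\<^sup>2 \<le> (cmod (f n) + cmod (g n))\<^sup>2"
    by (intro power_mono norm_triangle_ineq) auto
  also have "\<dots> \<le> 2 * (cmod (f n))\<^sup>2 + 2 * (cmod (g n))\<^sup>2"
    using sum_squares_bound[of "cmod (f n)" "cmod (g n)"] by (simp add: power2_sum)
  finally show "norm ((cmod (f n + g n))\<^sup>2) \<le> 2 * (cmod (f n))\<^sup>2 + 2 * (cmod (g n))\<^sup>2"
    by simp
qed

lemma summable_cmult_sq:
  fixes f :: "nat \<Rightarrow> complex"
  assumes "summable (\<lambda>n. (cmod (f n))\<^sup>2)"
  shows "summable (\<lambda>n. (cmod (c * f n))\<^sup>2)"
  using assms by (simp add: norm_mult power_mult_distrib summable_mult)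

definition cscale :: "complex \<Rightarrow> l2 \<Rightarrow> l2" (infixr "*\<^sub>C" 75)
  where "c *\<^sub>C x = Abs_l2 (\<lambda>n. c * coord x n)"

lemma coord_cscale [simp]: "coord (c *\<^sub>C x) n = c * coord x n"
  unfolding cscale_def by (intro coord_Abs_l2 summable_cmult_sq summable_coord_sq)

definition cinner :: "l2 \<Rightarrow> l2 \<Rightarrow> complex"
  where "cinner x y = (\<Sum>n. coord x n * cnj (coord y n))"

lemma summable_cinner: "summable (\<lambda>n. coord x n * cnj (coord y n))"
proof (rule summable_comparison_test')
  show "summable (\<lambda>n. (cmod (coord x n))\<^sup>2 + (cmod (coord y n))\<^sup>2)"
    by (intro summable_add summable_coord_sq)
  fix n
  have "0 \<le> cmod (coord x n) * cmod (coord y n)" by (rule mult_nonneg_nonneg) auto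
  then show "norm (coord x n * cnj (coord y n)) \<le> (cmod (coord x n))\<^sup>2 + (cmod (coord y n))\<^sup>2"
    using sum_squares_bound[of "cmod (coord x n)" "cmod (coord y n)"]
    unfolding norm_mult complex_mod_cnj real_norm_def by linarith
qed

lemma cinner_sums: "(\<lambda>n. coord x n * cnj (coord y n)) sums cinner x y"
  unfolding cinner_def by (rule summable_sums[OF summable_cinner])

instantiation l2 :: real_vector
begin
definition "0 = Abs_l2 (\<lambda>_. 0)"
definition "x + y = Abs_l2 (\<lambda>n. coord x n + coord y n)"
definition "- (x :: l2) = (-1) *\<^sub>C x"
definition "x - y = x + (- y :: l2)"
definition "scaleR a x = complex_of_real a *\<^sub>C x"

lemma coord_zero [simp]: "coord 0 n = 0"
  unfolding zero_l2_def by (simp add: coord_Abs_l2)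
lemma coord_add [simp]: "coord (x + y) n = coord x n + coord y n"
  unfolding plus_l2_def by (intro coord_Abs_l2 summable_add_sq summable_coord_sq)
lemma coord_uminus [simp]: "coord (- x) n = - coord x n"
  unfolding uminus_l2_def by simp
lemma coord_diff [simp]: "coord (x - y) n = coord x n - coord y n"
  unfolding minus_l2_def by simp
lemma coord_scaleR [simp]: "coord (a *\<^sub>R x) n = a *\<^sub>R coord x n"
  unfolding scaleR_l2_def by (simp add: scaleR_conv_of_real)

instance
  by standard (auto intro!: l2_eqI simp: scaleR_conv_of_real algebra_simps)
end

lemma cinner_commute: "cinner x y = cnj (cinner y x)"
proof -
  have "(\<lambda>n. cnj (coord y n * cnj (coord x n))) sums cnj (cinner y x)"
    unfolding sums_cnj by (rule cinner_sums)
  then have "(\<lambda>n. coord x n * cnj (coord y n)) sums cnj (cinner y x)"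
    by (simp add: mult.commute)
  then show ?thesis by (rule sums_unique2[OF cinner_sums])
qed

lemma cinner_add_left: "cinner (x + y) z = cinner x z + cinner y z"
  using sums_add[OF cinner_sums[of x z] cinner_sums[of y z]]
  by (intro sums_unique2[OF cinner_sums]) (simp add: algebra_simps)

lemma cinner_cscale_left [simp]: "cinner (c *\<^sub>C x) z = c * cinner x z"
  using sums_mult[OF cinner_sums[of x z], of c]
  by (intro sums_unique2[OF cinner_sums]) (simp add: algebra_simps)

lemma cinner_cscale_right [simp]: "cinner x (c *\<^sub>C z) = cnj c * cinner x z"
  by (simp add: cinner_commute[of x])

lemma cinner_self: "cinner x x = of_real (\<Sum>n. (cmod (coord x n))\<^sup>2)"
  unfolding cinner_def
  by (simp add: suminf_of_real[OF summable_coord_sq] mult_cnj_cmod)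

instantiation l2 :: real_inner
begin
definition "inner x y = Re (cinner x y)"
definition "norm x = sqrt (inner x (x :: l2))"
definition "dist x y = norm (x - (y :: l2))"
definition "sgn x = x /\<^sub>R norm (x :: l2)"
definition "(uniformity :: (l2 \<times> l2) filter) = (INF e\<in>{0 <..}. principal {(x, y). dist x y < e})"
definition "open (U :: l2 set) \<longleftrightarrow> (\<forall>x\<in>U. eventually (\<lambda>(x', y). x' = x \<longrightarrow> y \<in> U) uniformity)"

instance
proof
  fix x y z :: l2 and a :: real
  show "inner x y = inner y x"
    unfolding inner_l2_def by (subst cinner_commute) simp
  show "inner (x + y) z = inner x z + inner y z"
    unfolding inner_l2_def by (simp add: cinner_add_left)
  show "inner (a *\<^sub>R x) y = a * inner x y"
    unfolding inner_l2_def scaleR_l2_def by simp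
  show "0 \<le> inner x x"
    unfolding inner_l2_def cinner_self by (simp add: suminf_nonneg summable_coord_sq)
  show "inner x x = 0 \<longleftrightarrow> x = 0"
    unfolding inner_l2_def cinner_self
    by (auto simp: suminf_eq_zero_iff summable_coord_sq intro!: l2_eqI)
qed (simp_all add: norm_l2_def dist_l2_def sgn_l2_def uniformity_l2_def open_l2_def)
end

lemma norm_l2_sq: "(norm x)\<^sup>2 = (\<Sum>n. (cmod (coord x n))\<^sup>2)"
  by (simp add: power2_norm_eq_inner inner_l2_def cinner_self)

lemma cinner_self_norm: "cinner x x = of_real ((norm x)\<^sup>2)"
  by (simp add: norm_l2_sq cinner_self)

lemma sum_sq_coord_le_norm:
  assumes "finite N" shows "(\<Sum>n\<in>N. (cmod (coord x n))\<^sup>2) \<le> (norm x)\<^sup>2"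
  unfolding norm_l2_sq by (intro sum_le_suminf summable_coord_sq assms) auto

lemma norm_coord_le: "cmod (coord x n) \<le> norm x"
  using sum_sq_coord_le_norm[of "{n}" x] by (simp add: power2_le_iff_abs_le)

lemma norm_cscale [simp]: "norm (c *\<^sub>C x) = cmod c * norm x"
proof -
  have "cinner (c *\<^sub>C x) (c *\<^sub>C x) = of_real ((cmod c * norm x)\<^sup>2)"
    using cinner_self_norm[of x]
    by (simp add: power_mult_distrib mult_cnj_cmod flip: mult.assoc)
  then have "(norm (c *\<^sub>C x))\<^sup>2 = (cmod c * norm x)\<^sup>2"
    by (simp only: cinner_self_norm of_real_eq_iff)
  then show ?thesis by simp
qed

lemma bounded_linear_coord: "bounded_linear (\<lambda>x. coord x n)"
  by (rule bounded_linear_intro[of _ 1]) (auto simp: norm_coord_le)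

lemma bounded_linear_cscale: "bounded_linear ((*\<^sub>C) c)"
  by (rule bounded_linear_intro[of _ "cmod c"])
    (auto intro!: l2_eqI simp: algebra_simps scaleR_conv_of_real)

lemma cscale_simps [simp]:
  "1 *\<^sub>C x = x" "0 *\<^sub>C x = 0" "c *\<^sub>C 0 = 0" "c *\<^sub>C d *\<^sub>C x = (c * d) *\<^sub>C x"
  by (auto intro!: l2_eqI)

lemma cscale_distribs:
  "c *\<^sub>C (x + y) = c *\<^sub>C x + c *\<^sub>C y" "c *\<^sub>C (x - y) = c *\<^sub>C x - c *\<^sub>C y"
  "(c + d) *\<^sub>C x = c *\<^sub>C x + d *\<^sub>C x" "(c - d) *\<^sub>C x = c *\<^sub>C x - d *\<^sub>C x"
  by (auto intro!: l2_eqI simp: algebra_simps)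

lemma scaleR_cscale: "a *\<^sub>R x = complex_of_real a *\<^sub>C x"
  by (rule scaleR_l2_def)

lemma cmod_cinner_le: "cmod (cinner x y) \<le> norm x * norm y"
proof (cases "cinner x y = 0")
  case False
  define u where "u = cnj (cinner x y) / cmod (cinner x y)"
  have u: "cmod u = 1" using False by (simp add: u_def norm_divide)
  have "u * cinner x y = of_real (cmod (cinner x y))"
    using False by (simp add: u_def mult.commute mult_cnj_cmod power2_eq_square)
  then have "cmod (cinner x y) = inner (u *\<^sub>C x) y"
    by (simp add: inner_l2_def)
  also have "\<dots> \<le> norm (u *\<^sub>C x) * norm y" by (rule norm_cauchy_schwarz)
  finally show ?thesis by (simp add: u)
qed simp

lemma bounded_linear_cinner_left: "bounded_linear (\<lambda>x. cinner x y)"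
  by (rule bounded_linear_intro[of _ "norm y"])
    (auto simp: cinner_add_left scaleR_cscale scaleR_conv_of_real cmod_cinner_le mult.commute)

lemma bounded_linear_cinner_right: "bounded_linear (\<lambda>y. cinner x y)"
  using bounded_linear_compose[OF bounded_linear_cnj bounded_linear_cinner_left]
  by (subst cinner_commute)

lemmas cinner_simps =
  cinner_add_left bounded_linear.linear[OF bounded_linear_cinner_right, THEN linear_add]
  bounded_linear.linear[OF bounded_linear_cinner_left, THEN linear_diff]
  bounded_linear.linear[OF bounded_linear_cinner_right, THEN linear_diff]

lemma cinner_zero [simp]: "cinner 0 x = 0" "cinner x 0 = 0"
  by (simp_all add: cinner_def)

lemma cinner_eqI: "(\<And>x. cinner x y = cinner x z) \<Longrightarrow> y = z"
  using cinner_self_norm[of "y - z"] cinner_simps(4)[of "y - z" y z] by simp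

instance l2 :: complete_space
proof
  fix X :: "nat \<Rightarrow> l2" assume X: "Cauchy X"
  define l where "l n = lim (\<lambda>k. coord (X k) n)" for n
  have l: "(\<lambda>k. coord (X k) n) \<longlonglongrightarrow> l n" for n
    unfolding l_def
    using bounded_linear.Cauchy[OF bounded_linear_coord X, of n]
    by (simp add: Cauchy_convergent_iff convergent_LIMSEQ_iff)
  \<comment> \<open>Only coordinatewise limits are known here, so the Cauchy bound is passed to the
    limit on finite sections, with a bound that does not depend on N.\<close>
  have tail: "(\<Sum>n<N. (cmod (coord (X k) n - l n))\<^sup>2) \<le> e\<^sup>2"
    if k: "k \<ge> K" and K: "\<And>m. m \<ge> K \<Longrightarrow> norm (X k - X m) \<le> e" for K e k N
  proof (rule tendsto_upperbound)
    show "(\<lambda>m. \<Sum>n<N. (cmod (coord (X k) n - coord (X m) n))\<^sup>2)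
      \<longlonglongrightarrow> (\<Sum>n<N. (cmod (coord (X k) n - l n))\<^sup>2)"
      by (intro tendsto_intros l)
    have "(\<Sum>n<N. (cmod (coord (X k) n - coord (X m) n))\<^sup>2) \<le> e\<^sup>2" if "m \<ge> K" for m
    proof -
      have "(\<Sum>n<N. (cmod (coord (X k - X m) n))\<^sup>2) \<le> (norm (X k - X m))\<^sup>2"
        by (rule sum_sq_coord_le_norm) simp
      also have "\<dots> \<le> e\<^sup>2" using K[OF that] by (intro power_mono) auto
      finally show ?thesis by simp
    qed
    then show "\<forall>\<^sub>F m in sequentially. (\<Sum>n<N. (cmod (coord (X k) n - coord (X m) n))\<^sup>2) \<le> e\<^sup>2"
      by (auto simp: eventually_sequentially)
  qed simp
  have Kex: "\<exists>K. \<forall>k\<ge>K. \<forall>m\<ge>K. norm (X k - X m) \<le> e" if "e > 0" for e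
    using X that unfolding Cauchy_def dist_norm by (meson less_imp_le)
  have diff: "summable (\<lambda>n. (cmod (coord (X k) n - l n))\<^sup>2)
      \<and> (\<Sum>n. (cmod (coord (X k) n - l n))\<^sup>2) \<le> e\<^sup>2"
    if "k \<ge> K" "\<And>m. m \<ge> K \<Longrightarrow> norm (X k - X m) \<le> e" for K e k
  proof
    show s: "summable (\<lambda>n. (cmod (coord (X k) n - l n))\<^sup>2)"
      by (rule summableI_nonneg_bounded[of _ "e\<^sup>2"]) (auto intro: tail[OF that])
    show "(\<Sum>n. (cmod (coord (X k) n - l n))\<^sup>2) \<le> e\<^sup>2"
      by (intro suminf_le_const s tail[OF that])
  qed
  obtain K1 where K1: "\<forall>k\<ge>K1. \<forall>m\<ge>K1. norm (X k - X m) \<le> 1"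
    using Kex[of 1] by auto
  have "summable (\<lambda>n. (cmod (coord (X K1) n - l n))\<^sup>2)"
    using diff[of K1 K1 1] K1 by auto
  then have "summable (\<lambda>n. (cmod (coord (X K1) n + (-1) * (coord (X K1) n - l n)))\<^sup>2)"
    by (intro summable_add_sq summable_coord_sq summable_cmult_sq)
  then have lsum: "summable (\<lambda>n. (cmod (l n))\<^sup>2)" by simp
  have "X \<longlonglongrightarrow> Abs_l2 l"
  proof (rule LIMSEQ_I)
    fix e :: real assume e: "e > 0"
    obtain K where K: "\<forall>k\<ge>K. \<forall>m\<ge>K. norm (X k - X m) \<le> e/2"
      using Kex[of "e/2"] e by auto
    have "norm (X k - Abs_l2 l) < e" if "k \<ge> K" for k
    proof -
      have "(norm (X k - Abs_l2 l))\<^sup>2 \<le> (e/2)\<^sup>2"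
        using diff[of K k "e/2"] K that by (auto simp: norm_l2_sq coord_Abs_l2[OF lsum])
      then show ?thesis using e power2_le_imp_le[of "norm (X k - Abs_l2 l)" "e/2"] by auto
    qed
    then show "\<exists>no. \<forall>n\<ge>no. norm (X n - Abs_l2 l) < e" by blast
  qed
  then show "convergent X" by (auto simp: convergent_def)
qed

instance l2 :: banach ..

section \<open>Bases, adjoints and isometries\<close>

definition unit_vec :: "nat \<Rightarrow> l2" where "unit_vec n = Abs_l2 (\<lambda>m. if m = n then 1 else 0)"

lemma coord_unit_vec [simp]: "coord (unit_vec n) m = (if m = n then 1 else 0)"
proof -
  have "summable (\<lambda>m. (cmod (if m = n then 1 else 0))\<^sup>2)"
    by (rule summable_finite[of "{n}"]) auto
  then show ?thesis unfolding unit_vec_def by (simp add: coord_Abs_l2)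
qed

lemma cinner_unit_vec [simp]: "cinner x (unit_vec n) = coord x n"
proof -
  have "(\<lambda>m. if m = n then coord x m else 0) sums coord x n"
    by (rule sums_single)
  moreover have "(\<lambda>m. if m = n then coord x m else 0) = (\<lambda>m. coord x m * cnj (coord (unit_vec n) m))"
    by auto
  ultimately show ?thesis using cinner_sums[of x "unit_vec n"] sums_unique2 by metis
qed

lemma coord_sum: "coord (sum f A) n = (\<Sum>i\<in>A. coord (f i) n)"
  by (rule linear_sum[OF bounded_linear.linear[OF bounded_linear_coord]])

lemma unit_vec_expansion: "(\<lambda>n. coord x n *\<^sub>C unit_vec n) sums x"
  unfolding sums_def
proof (rule LIMSEQ_I)
  fix e :: real assume e: "e > 0"
  let ?P = "\<lambda>N. \<Sum>n<N. coord x n *\<^sub>C unit_vec n"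
  have c: "coord (?P N) m = (if m < N then coord x m else 0)" for N m
    by (simp add: coord_sum if_distrib cong: if_cong)
  have nrm: "(norm (?P N - x))\<^sup>2 = (\<Sum>n. (cmod (coord x (n + N)))\<^sup>2)" for N
  proof -
    have "(norm (?P N - x))\<^sup>2 = (\<Sum>m. (cmod (coord (?P N - x) m))\<^sup>2)"
      by (rule norm_l2_sq)
    also have "\<dots> = (\<Sum>m. (cmod (coord (?P N - x) (m + N)))\<^sup>2) + (\<Sum>m<N. (cmod (coord (?P N - x) m))\<^sup>2)"
      by (rule suminf_split_initial_segment[OF summable_coord_sq])
    also have "\<dots> = (\<Sum>n. (cmod (coord x (n + N)))\<^sup>2)"
      by (simp add: c)
    finally show ?thesis .
  qed
  obtain N0 where N0: "\<forall>n\<ge>N0. norm (\<Sum>i. (cmod (coord x (i + n)))\<^sup>2) < e\<^sup>2"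
    using suminf_exist_split[OF _ summable_coord_sq[of x], of "e\<^sup>2"] e by auto
  have "norm (?P N - x) < e" if "N \<ge> N0" for N
  proof -
    have "(norm (?P N - x))\<^sup>2 < e\<^sup>2" using N0 that nrm[of N] by fastforce
    then show ?thesis using e power_less_imp_less_base[of _ 2 e] by simp
  qed
  then show "\<exists>no. \<forall>n\<ge>no. norm (?P n - x) < e" by blast
qed

definition clinear_bdd :: "(l2 \<Rightarrow> l2) \<Rightarrow> bool" where
  "clinear_bdd A \<longleftrightarrow> bounded_linear A \<and> (\<forall>c x. A (c *\<^sub>C x) = c *\<^sub>C A x)"

lemma clinear_bddD:
  assumes "clinear_bdd A"
  shows "bounded_linear A" "A (c *\<^sub>C x) = c *\<^sub>C A x"
    "A (x + y) = A x + A y" "A (x - y) = A x - A y" "A 0 = 0"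
  using assms unfolding clinear_bdd_def
  by (auto simp: linear_add linear_diff linear_0 bounded_linear.linear)

lemma clinear_bddI:
  assumes "\<And>x y. A (x + y) = A x + A y" "\<And>c x. A (c *\<^sub>C x) = c *\<^sub>C A x"
    "\<And>x. norm (A x) \<le> K * norm x"
  shows "clinear_bdd A"
  unfolding clinear_bdd_def
  by (auto intro!: bounded_linear_intro[of _ K] simp: assms scaleR_cscale mult.commute)

lemma clinear_bdd_id: "clinear_bdd (\<lambda>x. x)"
  and clinear_bdd_cscale: "clinear_bdd A \<Longrightarrow> clinear_bdd (\<lambda>x. c *\<^sub>C A x)"
  and clinear_bdd_add: "clinear_bdd A \<Longrightarrow> clinear_bdd B \<Longrightarrow> clinear_bdd (\<lambda>x. A x + B x)"
  and clinear_bdd_diff: "clinear_bdd A \<Longrightarrow> clinear_bdd B \<Longrightarrow> clinear_bdd (\<lambda>x. A x - B x)"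
  and clinear_bdd_compose: "clinear_bdd A \<Longrightarrow> clinear_bdd B \<Longrightarrow> clinear_bdd (\<lambda>x. A (B x))"
  unfolding clinear_bdd_def
  by (auto intro: bounded_linear_ident bounded_linear_add bounded_linear_sub
      bounded_linear_compose[OF bounded_linear_cscale] bounded_linear_compose
      simp: cscale_distribs mult.commute)

lemma clinear_bdd_pos_bound:
  assumes "clinear_bdd A" shows "\<exists>K>0. \<forall>x. norm (A x) \<le> K * norm x"
  using bounded_linear.pos_bounded[OF clinear_bddD(1)[OF assms]] by (auto simp: mult.commute)

text \<open>The representing vector is read off the basis; its partial sums are controlled by
  testing the functional on them.\<close>

lemma riesz_representation:
  fixes F :: "l2 \<Rightarrow> complex"
  assumes F: "bounded_linear F" "\<And>c x. F (c *\<^sub>C x) = c * F x"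
  obtains m where "\<And>x. F x = cinner x m"
proof -
  interpret F: bounded_linear F by fact
  obtain K where K: "K > 0" "\<And>x. norm (F x) \<le> norm x * K" using F.pos_bounded by auto
  define f where "f n = cnj (F (unit_vec n))" for n
  have bnd: "(\<Sum>n<N. (cmod (f n))\<^sup>2) \<le> K\<^sup>2" for N
  proof -
    define s where "s = (\<Sum>n<N. (cmod (f n))\<^sup>2)"
    define x where "x = (\<Sum>n<N. f n *\<^sub>C unit_vec n)"
    have c: "coord x m = (if m < N then f m else 0)" for m
      by (simp add: x_def coord_sum if_distrib cong: if_cong)
    have "F x = (\<Sum>n<N. f n * F (unit_vec n))" by (simp add: x_def F.sum F(2))
    also have "\<dots> = of_real s"
      unfolding s_def of_real_sum f_def by (intro sum.cong refl) (simp add: mult_cnj_cmod mult.commute)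
    finally have Fx: "F x = of_real s" .
    have "(norm x)\<^sup>2 = (\<Sum>n\<in>{..<N}. (cmod (coord x n))\<^sup>2)"
      unfolding norm_l2_sq by (intro suminf_finite) (auto simp: c)
    then have nx: "(norm x)\<^sup>2 = s" by (simp add: s_def c)
    have s0: "s \<ge> 0" by (simp add: s_def sum_nonneg)
    have "s \<le> norm x * K" using K(2)[of x] Fx s0 by simp
    then have "norm x * norm x \<le> K * norm x" using nx by (simp add: power2_eq_square mult.commute)
    then have "norm x \<le> K" using K(1) by (cases "norm x = 0") auto
    then show ?thesis using nx by (metis norm_ge_zero power_mono s_def)
  qed
  have s: "summable (\<lambda>n. (cmod (f n))\<^sup>2)"
    by (rule summableI_nonneg_bounded[OF _ bnd]) auto
  have "F x = cinner x (Abs_l2 f)" for x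
  proof -
    have "(\<lambda>n. F (coord x n *\<^sub>C unit_vec n)) sums F x"
      by (rule F.sums[OF unit_vec_expansion])
    moreover have "F (coord x n *\<^sub>C unit_vec n) = coord x n * cnj (coord (Abs_l2 f) n)" for n
      by (simp add: F(2) coord_Abs_l2[OF s] f_def)
    ultimately show ?thesis using cinner_sums[of x "Abs_l2 f"] sums_unique2 by simp
  qed
  then show thesis by (rule that)
qed

lemma adjoint_exists:
  assumes A: "clinear_bdd A"
  obtains B where "clinear_bdd B" "\<And>x y. cinner (A x) y = cinner x (B y)"
proof -
  have "\<exists>m. \<forall>x. cinner (A x) y = cinner x m" for y
    by (rule riesz_representation[of "\<lambda>x. cinner (A x) y"])
      (auto simp: clinear_bddD[OF A]
        intro: bounded_linear_compose[OF bounded_linear_cinner_left] clinear_bddD[OF A])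
  then obtain B where B: "\<And>x y. cinner (A x) y = cinner x (B y)" by metis
  obtain K where K: "K > 0" "\<And>x. norm (A x) \<le> K * norm x"
    using clinear_bdd_pos_bound[OF A] by auto
  have "clinear_bdd B"
  proof (rule clinear_bddI[of _ K])
    fix x y c
    show "B (x + y) = B x + B y"
      by (rule cinner_eqI) (simp add: cinner_simps B[symmetric])
    show "B (c *\<^sub>C x) = c *\<^sub>C B x"
      by (rule cinner_eqI) (simp add: B[symmetric])
    have "(norm (B x))\<^sup>2 = cmod (cinner (A (B x)) x)" by (simp add: B cinner_self_norm norm_power)
    also have "\<dots> \<le> norm (A (B x)) * norm x" by (rule cmod_cinner_le)
    also have "\<dots> \<le> K * norm (B x) * norm x" using K by (intro mult_right_mono) auto
    finally have "norm (B x) * norm (B x) \<le> (K * norm x) * norm (B x)"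
      by (simp add: power2_eq_square mult_ac)
    then show "norm (B x) \<le> K * norm x" using K(1) by (cases "norm (B x) = 0") auto
  qed
  then show thesis using B by (rule that)
qed

lemma cinner_sum_left: "cinner (sum f A) y = (\<Sum>i\<in>A. cinner (f i) y)"
  by (rule linear_sum[OF bounded_linear.linear[OF bounded_linear_cinner_left]])

text \<open>Used twice: for the weighted powers of phi, and for an orthonormal sequence in the
  kernel of the adjoint. Finite sums obey Pythagoras, so square-summability of
  \<open>coord x\<close> gives the Cauchy criterion.\<close>

lemma orthonormal_synthesis:
  assumes u: "\<And>m n. cinner (u m) (u n) = (if m = n then 1 else 0)"
  obtains D where "clinear_bdd D" "\<And>x. (\<lambda>n. coord x n *\<^sub>C u n) sums D x"
    "\<And>x y. cinner (D x) (D y) = cinner x y"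
proof -
  have cu: "cinner (\<Sum>i\<in>A. c i *\<^sub>C u i) (u n) = (if n \<in> A then c n else 0)" if "finite A" for A c n
    using that by (simp add: cinner_sum_left u if_distrib cong: if_cong)
  have nrm: "(norm (\<Sum>i\<in>A. c i *\<^sub>C u i))\<^sup>2 = (\<Sum>i\<in>A. (cmod (c i))\<^sup>2)" if "finite A" for A c
  proof -
    let ?s = "\<Sum>i\<in>A. c i *\<^sub>C u i"
    have "cinner ?s ?s = (\<Sum>i\<in>A. c i * cnj (cinner ?s (u i)))"
      by (subst cinner_sum_left) (simp add: cinner_commute[of "u _"])
    also have "\<dots> = (\<Sum>i\<in>A. of_real ((cmod (c i))\<^sup>2))"
      by (intro sum.cong refl) (simp add: cu[OF that] mult_cnj_cmod)
    finally show ?thesis unfolding cinner_self_norm of_real_sum[symmetric] of_real_eq_iff .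
  qed
  have summ: "summable (\<lambda>n. coord x n *\<^sub>C u n)" for x
    unfolding summable_Cauchy
  proof (intro allI impI)
    fix e :: real assume e: "e > 0"
    then obtain N where N: "\<And>m n. m \<ge> N \<Longrightarrow> norm (\<Sum>k=m..<n. (cmod (coord x k))\<^sup>2) < e\<^sup>2"
      using summable_coord_sq[of x, unfolded summable_Cauchy, rule_format, of "e\<^sup>2"] by auto
    have "norm (\<Sum>k=m..<n. coord x k *\<^sub>C u k) < e" if "m \<ge> N" for m n
    proof -
      have "(norm (\<Sum>k=m..<n. coord x k *\<^sub>C u k))\<^sup>2 < e\<^sup>2"
        using N[OF that, of n] by (simp add: nrm sum_nonneg)
      then show ?thesis using e power_less_imp_less_base[of _ 2 e] by simp
    qed
    then show "\<exists>N. \<forall>m\<ge>N. \<forall>n. norm (\<Sum>k=m..<n. coord x k *\<^sub>C u k) < e" by blast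
  qed
  define D where "D x = (\<Sum>n. coord x n *\<^sub>C u n)" for x
  have Ds: "(\<lambda>n. coord x n *\<^sub>C u n) sums D x" for x
    unfolding D_def by (rule summable_sums[OF summ])
  have Du: "cinner (D x) (u m) = coord x m" for x m
  proof -
    have "(\<lambda>n. cinner (coord x n *\<^sub>C u n) (u m)) sums cinner (D x) (u m)"
      by (rule bounded_linear.sums[OF bounded_linear_cinner_left Ds])
    moreover have "(\<lambda>n. cinner (coord x n *\<^sub>C u n) (u m)) = (\<lambda>n. if n = m then coord x n else 0)"
      by (auto simp: u)
    ultimately show ?thesis using sums_single[of m "coord x"] sums_unique2 by simp
  qed
  have DD: "cinner (D x) (D y) = cinner x y" for x y
  proof -
    have "(\<lambda>n. cinner (coord x n *\<^sub>C u n) (D y)) sums cinner (D x) (D y)"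
      by (rule bounded_linear.sums[OF bounded_linear_cinner_left Ds])
    then show ?thesis using cinner_sums[of x y] sums_unique2
      by (simp add: cinner_commute[of "u _"] Du)
  qed
  have "clinear_bdd D"
  proof (rule clinear_bddI[of _ 1])
    fix x y c
    show "D (x + y) = D x + D y"
      using sums_add[OF Ds[of x] Ds[of y]] Ds[of "x + y"] sums_unique2
      by (simp add: cscale_distribs)
    show "D (c *\<^sub>C x) = c *\<^sub>C D x"
      using bounded_linear.sums[OF bounded_linear_cscale Ds[of x], of c] Ds[of "c *\<^sub>C x"] sums_unique2
      by simp
    have "cinner (D x) (D x) = cinner x x" by (rule DD)
    then have "(norm (D x))\<^sup>2 = (norm x)\<^sup>2" by (simp only: cinner_self_norm of_real_eq_iff)
    then show "norm (D x) \<le> 1 * norm x" by simp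
  qed
  then show thesis using Ds DD by (rule that)
qed

section \<open>Universality from a large kernel\<close>

text \<open>Stated for every Banach space because it is applied both to \<open>l2\<close> and to a
  space of operators, where the unknown is itself an operator.\<close>

lemma neumann_unique:
  fixes A :: "'a::banach \<Rightarrow> 'a"
  assumes A: "bounded_linear A" "\<And>x. norm (A x) \<le> q * norm x" and q: "q < 1"
  shows "\<exists>!y. y = x + A y"
proof -
  interpret A: bounded_linear A by fact
  \<comment> \<open>The fixed point theorem asks for a nonnegative constant, and \<open>q\<close>
    may be negative.\<close>
  define q' where "q' = max q 0"
  have "\<exists>!y. x + A y = y"
  proof (rule banach_fix_type[of q'])
    show "\<forall>y z. dist (x + A y) (x + A z) \<le> q' * dist y z"
    proof (intro allI)
      fix y z
      have "dist (x + A y) (x + A z) = norm (A (y - z))" by (simp add: dist_norm A.diff)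
      also have "\<dots> \<le> q * norm (y - z)" by (rule A(2))
      also have "\<dots> \<le> q' * norm (y - z)" by (intro mult_right_mono) (auto simp: q'_def)
      finally show "dist (x + A y) (x + A z) \<le> q' * dist y z" by (simp add: dist_norm)
    qed
  qed (use q in \<open>auto simp: q'_def\<close>)
  then show ?thesis by metis
qed

lemma neumann_inverse:
  assumes A: "clinear_bdd A" "\<And>x. norm (A x) \<le> q * norm x" and q: "q < 1"
  obtains R where "clinear_bdd R" "\<And>x. R x - A (R x) = x" "\<And>x. R (x - A x) = x"
proof -
  note un = neumann_unique[OF clinear_bddD(1)[OF A(1)] A(2) q]
  then have "\<exists>R. \<forall>x. R x = x + A (R x)" by metis
  then obtain R where R: "\<And>x. R x = x + A (R x)" by blast
  have uniq: "y = R x" if "y = x + A y" for x y using un[of x] R[of x] that by blast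
  have "clinear_bdd R"
  proof (rule clinear_bddI[of _ "1 / (1 - q)"])
    fix x y c
    show "R (x + y) = R x + R y"
      by (rule uniq[symmetric]) (subst (1 2) R, simp add: clinear_bddD(3)[OF A(1)])
    show "R (c *\<^sub>C x) = c *\<^sub>C R x"
      by (rule uniq[symmetric])
        (subst (1) R, simp add: clinear_bddD(2)[OF A(1)] cscale_distribs)
    have "norm (R x) \<le> norm x + norm (A (R x))" by (subst R) (rule norm_triangle_ineq)
    then have "norm (R x) * (1 - q) \<le> norm x" using A(2)[of "R x"] by (simp add: algebra_simps)
    then show "norm (R x) \<le> 1 / (1 - q) * norm x" using q by (simp add: field_simps)
  qed
  moreover have "R x - A (R x) = x" for x using R[of x] by (simp add: algebra_simps)
  moreover have "R (x - A x) = x" for x by (rule uniq[symmetric]) simp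
  ultimately show thesis by (rule that)
qed

text \<open>Expanding the square with t = 1/K^2 gives the terms -2 t |B x|^2 and t^2 |Bs (B x)|^2.
  The latter is at most t |B x|^2, so a gain of t |B x|^2, hence of (d^2/K^2) |x|^2, remains. In
  effect the lower bound on B makes \<open>Bs\<close> composed with B invertible.\<close>

lemma gram_contraction:
  fixes B Bs :: "l2 \<Rightarrow> l2"
  assumes adj: "\<And>x y. cinner (B x) y = cinner x (Bs y)"
    and bound: "\<And>y. norm (Bs y) \<le> K * norm y" and K: "K > 0"
    and below: "\<And>x. d * norm x \<le> norm (B x)" and d: "d > 0"
  shows "norm (x - (1/K\<^sup>2) *\<^sub>R Bs (B x)) \<le> sqrt (1 - d\<^sup>2/K\<^sup>2) * norm x"
proof -
  define t where "t = 1/K\<^sup>2"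
  have t: "t > 0" "t * K\<^sup>2 = 1" using K by (auto simp: t_def)
  have i: "inner x (Bs (B x)) = (norm (B x))\<^sup>2"
    by (simp add: inner_l2_def adj[symmetric] cinner_self_norm)
  have "(norm (Bs (B x)))\<^sup>2 \<le> (K * norm (B x))\<^sup>2" by (intro power_mono bound) auto
  then have "t\<^sup>2 * (norm (Bs (B x)))\<^sup>2 \<le> t\<^sup>2 * (K * norm (B x))\<^sup>2" using t by (intro mult_left_mono) auto
  also have "\<dots> = t * (t * K\<^sup>2) * (norm (B x))\<^sup>2" by (simp add: power2_eq_square)
  finally have 1: "t\<^sup>2 * (norm (Bs (B x)))\<^sup>2 \<le> t * (norm (B x))\<^sup>2" by (simp add: t)
  have "(d * norm x)\<^sup>2 \<le> (norm (B x))\<^sup>2" using d by (intro power_mono below) auto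
  then have 2: "t * (d * norm x)\<^sup>2 \<le> t * (norm (B x))\<^sup>2" using t by simp
  have "(norm (x - t *\<^sub>R w))\<^sup>2 = (norm x)\<^sup>2 - 2 * t * inner x w + t\<^sup>2 * (norm w)\<^sup>2" for w
    unfolding power2_norm_eq_inner
    by (simp add: inner_diff_left inner_diff_right inner_commute power2_eq_square algebra_simps)
  then have "(norm (x - t *\<^sub>R Bs (B x)))\<^sup>2
      = (norm x)\<^sup>2 - 2 * t * (norm (B x))\<^sup>2 + t\<^sup>2 * (norm (Bs (B x)))\<^sup>2"
    by (simp only: i)
  also have "\<dots> \<le> (norm x)\<^sup>2 - t * (d * norm x)\<^sup>2" using 1 2 by linarith
  also have "\<dots> = (1 - d\<^sup>2/K\<^sup>2) * (norm x)\<^sup>2"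
    by (simp add: t_def field_simps power_mult_distrib)
  finally have "norm (x - t *\<^sub>R Bs (B x)) \<le> sqrt ((1 - d\<^sup>2/K\<^sup>2) * (norm x)\<^sup>2)"
    by (rule real_le_rsqrt)
  then show ?thesis by (simp add: real_sqrt_mult t_def)
qed

text \<open>Caradus' criterion. With V isometric into the kernel of the surjection \<open>Bs = B\<^sup>*\<close>,
  set X = V + B Y; then Bs X = c X T becomes the fixed point equation
  Y = Y - t Bs B Y + t c (V + B Y) T, whose right-hand side is a contraction in Y once t and c are
  small. Since B Y is orthogonal to the range of V, X stays bounded below.\<close>

lemma caradus:
  fixes B Bs V T :: "l2 \<Rightarrow> l2"
  assumes B: "clinear_bdd B" and Bs: "clinear_bdd Bs"
    and adj: "\<And>x y. cinner (B x) y = cinner x (Bs y)"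
    and below: "\<And>x. d * norm x \<le> norm (B x)" and d: "d > 0"
    and V: "clinear_bdd V" and VV: "\<And>x y. cinner (V x) (V y) = cinner x y"
    and BsV: "\<And>x. Bs (V x) = 0"
    and T: "clinear_bdd T"
  obtains X c where "clinear_bdd X" "c \<noteq> 0" "\<And>x. norm x \<le> norm (X x)"
    "\<And>x. Bs (X x) = c *\<^sub>C X (T x)"
proof -
  obtain K where K: "K > 0" "\<And>y. norm (Bs y) \<le> K * norm y"
    using clinear_bdd_pos_bound[OF Bs] by auto
  define t where "t = 1/K\<^sup>2"
  define q where "q = sqrt (1 - d\<^sup>2/K\<^sup>2)"
  have t: "t > 0" using K by (simp add: t_def)
  have q: "q < 1" using d K unfolding q_def by simp
  have contr: "norm (x - t *\<^sub>R Bs (B x)) \<le> q * norm x" for x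
    unfolding q_def t_def by (rule gram_contraction[OF adj K(2) K(1) below d])
  \<comment> \<open>\<open>sqrt\<close> takes negative values at negative arguments, so the sign of
    \<open>q\<close> is not evident; the contraction estimate at a nonzero vector forces it.\<close>
  have "norm (unit_vec 0) \<noteq> 0"
    using coord_unit_vec[of 0 0] by (metis coord_zero norm_eq_zero zero_neq_one)
  then have q0: "0 \<le> q"
    using order_trans[OF norm_ge_zero contr[of "unit_vec 0"]] by (simp add: zero_le_mult_iff)
  obtain KT where KT: "KT > 0" "\<And>y. norm (T y) \<le> KT * norm y"
    using clinear_bdd_pos_bound[OF T] by auto
  obtain KB where KB: "KB > 0" "\<And>y. norm (B y) \<le> KB * norm y"
    using clinear_bdd_pos_bound[OF B] by auto
  \<comment> \<open>Chosen so that the term with \<open>T\<close> costs at most (1 - q)/2, half of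
    the room left by \<open>q\<close>; the total constant is then (1 + q)/2 < 1.\<close>
  define c where "c = (1 - q) / (2 * t * KB * KT)"
  have c: "c > 0" "t * c * KB * KT = (1 - q) / 2" using t q KB KT by (auto simp: c_def)
  define Bb Bsb Vb Tb where bl: "Bb = Blinfun B" "Bsb = Blinfun Bs" "Vb = Blinfun V" "Tb = Blinfun T"
  have app [simp]: "blinfun_apply Bb = B" "blinfun_apply Bsb = Bs"
    "blinfun_apply Vb = V" "blinfun_apply Tb = T"
    using B Bs V T by (simp_all add: bl bounded_linear_Blinfun_apply clinear_bddD(1))
  \<comment> \<open>The unknown Y ranges over the Banach space of bounded real linear maps; complex
    homogeneity of the solution is recovered afterwards.\<close>
  define A where "A Y = (Y - t *\<^sub>R (Bsb o\<^sub>L (Bb o\<^sub>L Y))) + (t * c) *\<^sub>R (Bb o\<^sub>L (Y o\<^sub>L Tb))" for Y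
  have Abl: "bounded_linear A"
    unfolding A_def
    by (intro bounded_linear_add bounded_linear_sub bounded_linear_ident
        bounded_linear_compose[OF bounded_linear_scaleR_right]
        bounded_linear_compose[OF bounded_bilinear.bounded_linear_right[OF bounded_bilinear_blinfun_compose]]
        bounded_bilinear.bounded_linear_left[OF bounded_bilinear_blinfun_compose])
  have Ale: "norm (A Y) \<le> ((1 + q) / 2) * norm Y" for Y
  proof (rule norm_blinfun_bound)
    show "0 \<le> (1 + q) / 2 * norm Y" using q0 by simp
    fix x
    have "norm (A Y x) \<le> norm (Y x - t *\<^sub>R Bs (B (Y x))) + norm ((t * c) *\<^sub>R B (Y (T x)))"
      unfolding A_def by (simp add: blinfun.bilinear_simps norm_triangle_ineq del: norm_scaleR)
    also have "norm (Y x - t *\<^sub>R Bs (B (Y x))) \<le> q * norm (Y x)"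
      by (rule contr)
    also have "norm ((t * c) *\<^sub>R B (Y (T x))) \<le> ((1 - q) / 2) * (norm Y * norm x)"
    proof -
      have "norm (B (Y (T x))) \<le> KB * norm (Y (T x))" by (rule KB)
      also have "\<dots> \<le> KB * (norm Y * norm (T x))"
        using KB norm_blinfun by (intro mult_left_mono) auto
      also have "\<dots> \<le> KB * (norm Y * (KT * norm x))"
        using KB KT by (intro mult_left_mono) auto
      finally have "norm ((t * c) *\<^sub>R B (Y (T x))) \<le> (t * c) * (KB * (norm Y * (KT * norm x)))"
        using t c by simp
      also have "\<dots> = (t * c * KB * KT) * (norm Y * norm x)" by (simp add: mult_ac)
      finally show ?thesis by (simp add: c)
    qed
    also have "q * norm (Y x) \<le> q * (norm Y * norm x)"
      by (rule mult_left_mono[OF norm_blinfun q0])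
    finally show "norm (A Y x) \<le> (1 + q) / 2 * norm Y * norm x"
      by (simp add: field_simps)
  qed
  define Z where "Z = (t * c) *\<^sub>R (Vb o\<^sub>L Tb)"
  have un: "\<exists>!Y. Y = Z + A Y"
    by (rule neumann_unique[OF Abl Ale]) (use q in simp)
  then obtain Y where Y: "Y = Z + A Y" by blast
  have fix_iff: "Y' = Z + A Y' \<longleftrightarrow> (\<forall>x. Bs (B (Y' x)) = c *\<^sub>R (V (T x) + B (Y' (T x))))" for Y'
  proof -
    have "Y' = Z + A Y' \<longleftrightarrow> (\<forall>x. Y' x = (Z + A Y') x)" by (auto intro: blinfun_eqI)
    also have "\<dots> \<longleftrightarrow> (\<forall>x. t *\<^sub>R Bs (B (Y' x)) = t *\<^sub>R (c *\<^sub>R (V (T x) + B (Y' (T x)))))"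
      unfolding Z_def A_def by (simp add: blinfun.bilinear_simps scaleR_add_right algebra_simps)
    also have "\<dots> \<longleftrightarrow> (\<forall>x. Bs (B (Y' x)) = c *\<^sub>R (V (T x) + B (Y' (T x))))"
      using t by (simp only: scaleR_cancel_left) simp
    finally show ?thesis .
  qed
  have eqY: "Bs (B (Y x)) = c *\<^sub>R (V (T x) + B (Y (T x)))" for x
    using Y fix_iff by blast
  note lins = clinear_bddD[OF B] clinear_bddD[OF Bs] clinear_bddD[OF V] clinear_bddD[OF T]
  have Ylin: "clinear_bdd Y"
    unfolding clinear_bdd_def
  proof (intro conjI allI)
    show "bounded_linear Y" by (rule blinfun.bounded_linear_right)
    fix a x
    show "Y (a *\<^sub>C x) = a *\<^sub>C Y x"
    proof (cases "a = 0")
      case False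
      \<comment> \<open>Conjugating the solution by the scalar \<open>a\<close> gives a solution of
        the same equation, so uniqueness yields complex homogeneity.\<close>
      define Y' where "Y' = Blinfun (\<lambda>x. inverse a *\<^sub>C Y (a *\<^sub>C x))"
      have Y'x: "Y' x = inverse a *\<^sub>C Y (a *\<^sub>C x)" for x
        unfolding Y'_def
        by (subst bounded_linear_Blinfun_apply)
          (intro bounded_linear_compose[OF bounded_linear_cscale] bounded_linear_cscale
            bounded_linear_compose[OF blinfun.bounded_linear_right], rule refl)
      have cancel: "c' * a * inverse a = c'" for c' using False by simp
      have "Bs (B (Y' x)) = c *\<^sub>R (V (T x) + B (Y' (T x)))" for x
        unfolding Y'x lins eqY scaleR_cscale cscale_distribs cscale_simps
        by (simp only: mult.commute[of "inverse a"] cancel)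
      then have "Y' = Y" using un Y fix_iff[of Y'] by blast
      then have "a *\<^sub>C Y x = a *\<^sub>C inverse a *\<^sub>C Y (a *\<^sub>C x)" using Y'x by metis
      then show ?thesis using False by simp
    qed (simp add: blinfun.zero_right)
  qed
  define X where "X x = V x + B (Y x)" for x
  have Xlin: "clinear_bdd X"
    unfolding X_def by (intro clinear_bdd_add V clinear_bdd_compose[OF B Ylin])
  have "norm x \<le> norm (X x)" for x
  proof -
    have "cinner (X x) (V x) = cinner x x"
      unfolding X_def by (simp add: cinner_simps VV adj BsV)
    then have "(norm x)\<^sup>2 = cmod (cinner (X x) (V x))" by (simp add: cinner_self_norm norm_power)
    also have "\<dots> \<le> norm (X x) * norm (V x)" by (rule cmod_cinner_le)
    also have "norm (V x) = norm x"
      by (simp add: norm_eq_sqrt_inner inner_l2_def VV)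
    finally have "norm x * norm x \<le> norm (X x) * norm x" by (simp add: power2_eq_square)
    then show ?thesis by (cases "norm x = 0") auto
  qed
  moreover have "Bs (X x) = complex_of_real c *\<^sub>C X (T x)" for x
    unfolding X_def by (simp add: lins BsV eqY scaleR_cscale)
  ultimately show thesis using c by (intro that[OF Xlin, of "complex_of_real c"]) auto
qed

section \<open>Orthonormal sequences in infinite-dimensional subspaces\<close>

lemma infinite_dim_Int_kernel:
  fixes S :: "'a::real_vector set" and F :: "'a \<Rightarrow> real"
  assumes S: "subspace S" "\<nexists>G. finite G \<and> S \<subseteq> span G" and F: "linear F"
  shows "subspace (S \<inter> {x. F x = 0})" "\<nexists>G. finite G \<and> S \<inter> {x. F x = 0} \<subseteq> span G"
proof -
  show "subspace (S \<inter> {x. F x = 0})"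
    using S(1) by (auto simp: subspace_def linear_add[OF F] linear_cmul[OF F] linear_0[OF F])
  show "\<nexists>G. finite G \<and> S \<inter> {x. F x = 0} \<subseteq> span G"
  proof
    assume "\<exists>G. finite G \<and> S \<inter> {x. F x = 0} \<subseteq> span G"
    then obtain G where G: "finite G" "S \<inter> {x. F x = 0} \<subseteq> span G" by blast
    show False
    proof (cases "\<forall>x\<in>S. F x = 0")
      case True
      then show False using S(2) G by blast
    next
      case False
      then obtain z where z: "z \<in> S" "F z \<noteq> 0" by blast
      have "x \<in> span (insert z G)" if "x \<in> S" for x
      proof -
        \<comment> \<open>Subtracting a multiple of \<open>z\<close> moves \<open>x\<close> into the
          kernel of \<open>F\<close>, so adding the single vector \<open>z\<close> to
          \<open>G\<close> would span all of \<open>S\<close>.\<close>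
        let ?y = "x - (F x / F z) *\<^sub>R z"
        have "?y \<in> S" using S(1) that z by (intro subspace_diff subspace_scale) auto
        moreover have "F ?y = 0" using z by (simp add: linear_diff[OF F] linear_cmul[OF F])
        ultimately have "?y \<in> span (insert z G)"
          using G(2) span_mono[of G "insert z G"] by blast
        moreover have "(F x / F z) *\<^sub>R z \<in> span (insert z G)"
          by (intro span_scale span_base) simp
        ultimately have "?y + (F x / F z) *\<^sub>R z \<in> span (insert z G)" by (rule span_add)
        then show ?thesis by simp
      qed
      then show False using S(2) G(1) by (meson finite_insert subsetI)
    qed
  qed
qed

text \<open>\<open>span\<close> is the real span, so each complex orthogonality condition is treated
  as two real hyperplanes, its real and its imaginary part.\<close>

lemma infinite_dim_orthogonal_unit:
  fixes S :: "l2 set"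
  assumes "finite N" and S: "subspace S" "\<nexists>G. finite G \<and> S \<subseteq> span G"
  shows "\<exists>x\<in>S. norm x = 1 \<and> (\<forall>y\<in>N. cinner x y = 0)"
proof -
  have "subspace (S \<inter> {x. \<forall>y\<in>N. cinner x y = 0}) \<and>
      (\<nexists>G. finite G \<and> S \<inter> {x. \<forall>y\<in>N. cinner x y = 0} \<subseteq> span G)"
    using assms(1)
  proof (induction N)
    case empty
    then show ?case using S by simp
  next
    case (insert y N)
    let ?S = "S \<inter> {x. \<forall>y\<in>N. cinner x y = 0}"
    have lin: "linear (\<lambda>x. Re (cinner x y))" "linear (\<lambda>x. Im (cinner x y))"
      by (intro bounded_linear.linear bounded_linear_compose[OF bounded_linear_Re]
          bounded_linear_compose[OF bounded_linear_Im] bounded_linear_cinner_left)+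
    have "S \<inter> {x. \<forall>y\<in>insert y N. cinner x y = 0}
        = ?S \<inter> {x. Re (cinner x y) = 0} \<inter> {x. Im (cinner x y) = 0}"
      by (auto simp: complex_eq_iff)
    then show ?case
      using infinite_dim_Int_kernel[OF infinite_dim_Int_kernel[of ?S, OF _ _ lin(1)] lin(2)] insert.IH
      by simp
  qed
  then obtain x where x: "x \<in> S" "\<forall>y\<in>N. cinner x y = 0" "x \<noteq> 0"
  proof -
    have "\<not> S \<inter> {x. \<forall>y\<in>N. cinner x y = 0} \<subseteq> span {}"
      using \<open>subspace _ \<and> _\<close> by blast
    then show ?thesis using that by auto
  qed
  have "x /\<^sub>R norm x \<in> S" using S(1) x(1) by (rule subspace_scale)
  moreover have "norm (x /\<^sub>R norm x) = 1" using x by simp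
  moreover have "\<forall>y\<in>N. cinner (x /\<^sub>R norm x) y = 0" using x by (simp add: scaleR_cscale)
  ultimately show ?thesis by blast
qed

lemma infinite_dim_orthonormal_sequence:
  fixes S :: "l2 set"
  assumes S: "subspace S" "\<nexists>G. finite G \<and> S \<subseteq> span G"
  shows "\<exists>u :: nat \<Rightarrow> l2. (\<forall>n. u n \<in> S) \<and> (\<forall>m n. cinner (u m) (u n) = (if m = n then 1 else 0))"
proof -
  have "\<exists>G. \<forall>N. finite N \<longrightarrow> G N \<in> S \<and> norm (G N) = 1 \<and> (\<forall>y\<in>N. cinner (G N) y = 0)"
    using infinite_dim_orthogonal_unit[OF _ S] by metis
  then obtain G where G: "\<And>N. finite N \<Longrightarrow> G N \<in> S"
    "\<And>N. finite N \<Longrightarrow> norm (G N) = 1" "\<And>N y. finite N \<Longrightarrow> y \<in> N \<Longrightarrow> cinner (G N) y = 0"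
    by blast
  \<comment> \<open>The vectors chosen so far are kept as a finite set, since \<open>G\<close> picks
    a unit vector orthogonal to a given finite set.\<close>
  define P where "P = rec_nat ({} :: l2 set) (\<lambda>_ N. insert (G N) N)"
  have P: "P 0 = {}" "P (Suc n) = insert (G (P n)) (P n)" for n by (simp_all add: P_def)
  have fin: "finite (P n)" for n by (induction n) (simp_all add: P)
  have mem: "G (P m) \<in> P n" if "m < n" for m n
    using that by (induction n) (auto simp: P less_Suc_eq)
  have lt: "cinner (G (P n)) (G (P m)) = 0" if "m < n" for m n
    by (rule G(3)[OF fin mem[OF that]])
  have gt: "cinner (G (P m)) (G (P n)) = 0" if "m < n" for m n
    using lt[OF that] cinner_commute[of "G (P m)" "G (P n)"] by simp
  have self: "cinner (G (P n)) (G (P n)) = 1" for n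
    by (simp add: cinner_self_norm G(2)[OF fin])
  show ?thesis
  proof (intro exI[of _ "\<lambda>n. G (P n)"] conjI allI)
    show "G (P n) \<in> S" for n by (rule G(1)[OF fin])
    show "cinner (G (P m)) (G (P n)) = (if m = n then 1 else 0)" for m n
      using lt gt self by (cases m n rule: linorder_cases) auto
  qed
qed

section \<open>Point evaluations and the shift\<close>

text \<open>Multiplication by z on the Hardy space. In the coordinates used later for
  \<open>S2\<close> it has a second role: it sends the coefficients of a derivative to the primitive
  vanishing at 0.\<close>

definition shift :: "l2 \<Rightarrow> l2" where
  "shift x = Abs_l2 (\<lambda>n. case n of 0 \<Rightarrow> 0 | Suc m \<Rightarrow> coord x m)"

definition unshift :: "l2 \<Rightarrow> l2" where
  "unshift x = Abs_l2 (\<lambda>n. coord x (Suc n))"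

lemma coord_shift [simp]: "coord (shift x) 0 = 0" "coord (shift x) (Suc n) = coord x n"
proof -
  have "summable (\<lambda>n. (cmod (case n of 0 \<Rightarrow> 0 | Suc m \<Rightarrow> coord x m))\<^sup>2)"
    by (subst summable_Suc_iff[symmetric]) (simp add: summable_coord_sq)
  then show "coord (shift x) 0 = 0" "coord (shift x) (Suc n) = coord x n"
    by (simp_all add: shift_def coord_Abs_l2)
qed

lemma coord_unshift [simp]: "coord (unshift x) n = coord x (Suc n)"
  unfolding unshift_def using summable_coord_sq[of x]
  by (intro coord_Abs_l2) (simp add: summable_Suc_iff[of "\<lambda>n. (cmod (coord x n))\<^sup>2"])

lemma unshift_shift [simp]: "unshift (shift x) = x"
  by (auto intro!: l2_eqI)

lemma shift_unshift: "shift (unshift x) = x - coord x 0 *\<^sub>C unit_vec 0"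
proof (rule l2_eqI)
  show "coord (shift (unshift x)) n = coord (x - coord x 0 *\<^sub>C unit_vec 0) n" for n
    by (cases n) auto
qed

lemma cinner_shift_left: "cinner (shift x) y = cinner x (unshift y)"
proof -
  have "(\<lambda>n. coord (shift x) (Suc n) * cnj (coord y (Suc n))) sums cinner x (unshift y)"
    using cinner_sums[of x "unshift y"] by simp
  then have "(\<lambda>n. coord (shift x) n * cnj (coord y n)) sums cinner x (unshift y)"
    by (subst (asm) sums_Suc_iff) simp
  then show ?thesis by (rule sums_unique2[OF cinner_sums])
qed

lemma cinner_shift_right: "cinner x (shift y) = cinner (unshift x) y"
  by (simp add: cinner_commute[of x] cinner_shift_left flip: cinner_commute)

lemma norm_eqI_cinner: "cinner x x = cinner y y \<Longrightarrow> norm x = norm y"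
  by (simp add: norm_eq_sqrt_inner inner_l2_def)

lemma norm_shift [simp]: "norm (shift x) = norm x"
  by (rule norm_eqI_cinner) (simp add: cinner_shift_left)

lemma clinear_bdd_shift: "clinear_bdd shift"
proof (rule clinear_bddI[of _ 1])
  fix x y c
  show "shift (x + y) = shift x + shift y"
    by (rule l2_eqI, rename_tac n, case_tac n) auto
  show "shift (c *\<^sub>C x) = c *\<^sub>C shift x"
    by (rule l2_eqI, rename_tac n, case_tac n) auto
qed simp

lemma clinear_bdd_unshift: "clinear_bdd unshift"
proof (rule clinear_bddI[of _ 1])
  fix x y c
  show "unshift (x + y) = unshift x + unshift y" "unshift (c *\<^sub>C x) = c *\<^sub>C unshift x"
    by (auto intro!: l2_eqI)
  have "(norm (unshift x))\<^sup>2 = cmod (cinner x (shift (unshift x)))"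
    by (simp add: cinner_shift_right cinner_self_norm norm_power)
  also have "\<dots> \<le> norm x * norm (unshift x)" using cmod_cinner_le[of x "shift (unshift x)"] by simp
  finally show "norm (unshift x) \<le> 1 * norm x"
    by (cases "norm (unshift x) = 0") (auto simp: power2_eq_square)
qed

text \<open>The reproducing kernel of the Hardy space at z. The conjugate compensates the
  conjugate-linear second argument of \<open>cinner\<close>; off the open disc the sequence is not
  square-summable and the value is unspecified.\<close>

definition kern :: "complex \<Rightarrow> l2" where "kern z = Abs_l2 (\<lambda>n. cnj z ^ n)"

definition eval :: "l2 \<Rightarrow> complex \<Rightarrow> complex" where "eval x z = cinner x (kern z)"

lemma coord_kern: "cmod z < 1 \<Longrightarrow> coord (kern z) n = cnj z ^ n"
  unfolding kern_def
proof (rule coord_Abs_l2)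
  assume "cmod z < 1"
  then have "(cmod z)\<^sup>2 < 1" by (simp add: power_less_one_iff)
  then show "summable (\<lambda>n. (cmod (cnj z ^ n))\<^sup>2)"
    by (simp add: norm_power power_mult[symmetric] mult.commute[of _ 2])
      (simp add: power_mult summable_geometric)
qed

lemma eval_sums: "cmod z < 1 \<Longrightarrow> (\<lambda>n. coord x n * z ^ n) sums eval x z"
  using cinner_sums[of x "kern z"] by (simp add: eval_def coord_kern)

lemma norm_kern: "cmod z < 1 \<Longrightarrow> (norm (kern z))\<^sup>2 = 1 / (1 - (cmod z)\<^sup>2)"
proof -
  assume z: "cmod z < 1"
  then have "(cmod z)\<^sup>2 < 1" by (simp add: power_less_one_iff)
  then have "(\<lambda>n. ((cmod z)\<^sup>2) ^ n) sums (1 / (1 - (cmod z)\<^sup>2))"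
    by (intro geometric_sums) simp
  moreover have "(cmod (coord (kern z) n))\<^sup>2 = ((cmod z)\<^sup>2) ^ n" for n
    by (simp add: coord_kern[OF z] norm_power power_mult[symmetric] mult.commute)
  ultimately show ?thesis unfolding norm_l2_sq by (simp add: sums_iff)
qed

lemma bounded_linear_eval: "bounded_linear (\<lambda>x. eval x z)"
  unfolding eval_def by (rule bounded_linear_cinner_left)

lemma eval_add [simp]: "eval (x + y) z = eval x z + eval y z"
  and eval_diff [simp]: "eval (x - y) z = eval x z - eval y z"
  and eval_cscale [simp]: "eval (c *\<^sub>C x) z = c * eval x z"
  unfolding eval_def by (simp_all add: cinner_simps)

lemma eval_shift [simp]:
  assumes z: "cmod z < 1" shows "eval (shift x) z = z * eval x z"
proof -
  have "(\<lambda>n. coord (shift x) (Suc n) * z ^ Suc n) sums (z * eval x z)"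
    using sums_mult[OF eval_sums[OF z, of x], of z] by (simp add: mult_ac)
  then have "(\<lambda>n. coord (shift x) n * z ^ n) sums (z * eval x z)"
    by (subst (asm) sums_Suc_iff) simp
  then show ?thesis by (rule sums_unique2[OF eval_sums[OF z]])
qed

lemma eval_unit_vec_0 [simp]: "cmod z < 1 \<Longrightarrow> eval (unit_vec 0) z = 1"
  unfolding eval_def by (subst cinner_commute) (simp add: coord_kern)

section \<open>The weighted composition operator\<close>

lemma one_plus_rz_nonzero:
  assumes "\<bar>r\<bar> < 1" "cmod z < 1" shows "1 + complex_of_real r * z \<noteq> 0"
proof
  assume "1 + complex_of_real r * z = 0"
  then have "complex_of_real r * z = -1" by (simp add: add_eq_0_iff)
  then have "\<bar>r\<bar> * cmod z = 1" by (metis norm_minus_cancel norm_mult norm_of_real norm_one)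
  moreover have "\<bar>r\<bar> * cmod z < 1 * 1" using assms by (intro mult_strict_mono') auto
  ultimately show False by simp
qed

lemma one_minus_cmod_phi_sq:
  assumes "\<bar>r\<bar> < 1" "cmod z < 1"
  shows "1 - (cmod (phi r z))\<^sup>2 = (1 - r\<^sup>2) * (1 - (cmod z)\<^sup>2) / (cmod (1 + complex_of_real r * z))\<^sup>2"
proof -
  have nz: "(cmod (1 + complex_of_real r * z))\<^sup>2 \<noteq> 0" using one_plus_rz_nonzero[OF assms] by simp
  have "(cmod (1 + complex_of_real r * z))\<^sup>2 - (cmod (z + complex_of_real r))\<^sup>2
      = (1 - r\<^sup>2) * (1 - (cmod z)\<^sup>2)"
    unfolding cmod_power2 by (simp add: power2_eq_square algebra_simps)
  then show ?thesis using nz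
    by (simp add: phi_def norm_divide power_divide diff_divide_eq_iff field_simps)
qed

lemma cmod_phi_less_1:
  assumes "\<bar>r\<bar> < 1" "cmod z < 1" shows "cmod (phi r z) < 1"
proof -
  have "r\<^sup>2 < 1" using assms(1) by (simp add: abs_square_less_1)
  moreover have "(cmod z)\<^sup>2 < 1" using assms(2) by (simp add: power_less_one_iff)
  ultimately have "1 - (cmod (phi r z))\<^sup>2 > 0"
    unfolding one_minus_cmod_phi_sq[OF assms] using one_plus_rz_nonzero[OF assms]
    by (intro divide_pos_pos mult_pos_pos) auto
  then show ?thesis by (simp add: abs_square_less_1)
qed

text \<open>The functions \<open>(sqrt (1 - r\<^sup>2) / (1 + r z)) \<phi>\<^sub>r\<^sup>n\<close> are orthonormal, because multiplication by
  \<open>\<phi>\<^sub>r\<close> is an isometry M and the first of them is a multiple of the kernel at the zero -r of \<open>\<phi>\<^sub>r\<close>.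
  Hence \<open>D x = (sqrt (1 - r\<^sup>2) / (1 + r z)) (x \<circ> \<phi>\<^sub>r)\<close> is an isometry, and
  \<open>\<phi>\<^sub>r' (x \<circ> \<phi>\<^sub>r) = (sqrt (1 - r\<^sup>2) / (1 + r z)) D x\<close>.\<close>

lemma weighted_composition_exists:
  fixes r :: real
  assumes r: "\<bar>r\<bar> < 1"
  obtains k where "clinear_bdd k"
    "\<And>x (z::complex). cmod z < 1 \<Longrightarrow>
      eval (k x) z = sqrt (1 - r\<^sup>2) / (1 + r * z)\<^sup>2 * eval x (phi r z)"
    "\<And>x y. cinner (k x + r *\<^sub>C shift (k x)) (k y + r *\<^sub>C shift (k y)) = cinner x y"
    "\<And>x y. cinner (shift (k x) + r *\<^sub>C k x) (k y + r *\<^sub>C shift (k y)) = cinner (shift x) y"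
proof -
  note S = clinear_bddD[OF clinear_bdd_shift]
  \<comment> \<open>With this choice \<open>R\<close> inverts multiplication by 1 + r z, and
    \<open>M\<close> below becomes multiplication by phi.\<close>
  define A where "A x = (- complex_of_real r) *\<^sub>C shift x" for x
  have "clinear_bdd A" unfolding A_def by (intro clinear_bdd_cscale clinear_bdd_shift)
  moreover have "norm (A x) \<le> \<bar>r\<bar> * norm x" for x by (simp add: A_def)
  ultimately obtain R where R: "clinear_bdd R" "\<And>x. R x - A (R x) = x" "\<And>x. R (x - A x) = x"
    using neumann_inverse[of A "\<bar>r\<bar>"] r by blast
  have minus_A: "x - A x = x + r *\<^sub>C shift x" for x
    by (rule l2_eqI) (simp add: A_def)
  note R2 = R(2)[unfolded minus_A] and R3 = R(3)[unfolded minus_A]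
  note RL = clinear_bddD[OF R(1)]
  define M where "M x = shift (R x) + r *\<^sub>C R x" for x
  have M: "clinear_bdd M"
    unfolding M_def by (intro clinear_bdd_add clinear_bdd_cscale R clinear_bdd_compose[OF clinear_bdd_shift])
  \<comment> \<open>The algebraic counterpart of |z + r| = |1 + r z| on the unit circle: both inner
    products expand to the same terms in \<open>R x\<close> and \<open>R y\<close>.\<close>
  have MM: "cinner (M x) (M y) = cinner x y" for x y
  proof -
    have "cinner x y = cinner (R x + r *\<^sub>C shift (R x)) (R y + r *\<^sub>C shift (R y))"
      by (simp only: R2)
    then show ?thesis
      unfolding M_def by (simp add: cinner_simps cinner_shift_left algebra_simps)
  qed
  define v where "v = R (unit_vec 0)"
  have v: "v + r *\<^sub>C shift v = unit_vec 0" unfolding v_def by (rule R2)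
  \<comment> \<open>\<open>v\<close> is the kernel at -r, hence an eigenvector of the backward
    shift; this is what makes it orthogonal to the range of \<open>M\<close>.\<close>
  have unv: "unshift v = (- complex_of_real r) *\<^sub>C v"
  proof (rule l2_eqI)
    fix n
    have "coord (v + r *\<^sub>C shift v) (Suc n) = coord (unit_vec 0) (Suc n)" by (simp only: v)
    then show "coord (unshift v) n = coord ((- complex_of_real r) *\<^sub>C v) n"
      by (simp add: eq_neg_iff_add_eq_0)
  qed
  have r2: "1 - r\<^sup>2 > 0" using r by (simp add: abs_square_less_1)
  have vv: "(1 - (complex_of_real r)\<^sup>2) * cinner v v = 1"
  proof -
    have "1 = cinner (v + r *\<^sub>C shift v) (v + r *\<^sub>C shift v)" unfolding v by simp
    then show ?thesis
      by (simp add: cinner_simps cinner_shift_left cinner_shift_right[of v v] unv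
          power2_eq_square algebra_simps)
  qed
  \<comment> \<open>The normalising factor of \<open>v\<close>, since \<open>vv\<close> gives |v|^2
    = 1/(1 - r^2).\<close>
  define s where "s = complex_of_real (sqrt (1 - r\<^sup>2))"
  have s: "s * cnj s = 1 - (complex_of_real r)\<^sup>2"
    unfolding s_def using r2 by (simp flip: of_real_mult of_real_power)
  define u where "u n = (M ^^ n) (s *\<^sub>C v)" for n
  have u: "u 0 = s *\<^sub>C v" "u (Suc n) = M (u n)" for n by (simp_all add: u_def)
  have Mv: "cinner (M x) v = 0" for x
    unfolding M_def by (simp add: cinner_simps cinner_shift_left unv)
  have lt: "cinner (u n) (u m) = 0" if "m < n" for m n
    using that
  proof (induction m arbitrary: n)
    case 0
    then show ?case by (cases n) (auto simp: u Mv)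
  next
    case (Suc m)
    then show ?case by (cases n) (auto simp: u MM)
  qed
  have self: "cinner (u n) (u n) = 1" for n
  proof (induction n)
    case 0
    have "cinner (u 0) (u 0) = (s * cnj s) * cinner v v" by (simp add: u mult_ac)
    then show ?case using vv s by simp
  qed (simp add: u MM)
  have orth: "cinner (u m) (u n) = (if m = n then 1 else 0)" for m n
    using lt[of m n] lt[of n m] self cinner_commute[of "u m" "u n"]
    by (cases m n rule: linorder_cases) auto
  obtain D where D: "clinear_bdd D" "\<And>x. (\<lambda>n. coord x n *\<^sub>C u n) sums D x"
    "\<And>x y. cinner (D x) (D y) = cinner x y"
    using orthonormal_synthesis[OF orth] by blast
  have DS: "D (shift x) = M (D x)" for x
  proof -
    have "(\<lambda>n. M (coord x n *\<^sub>C u n)) sums M (D x)"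
      by (rule bounded_linear.sums[OF clinear_bddD(1)[OF M] D(2)])
    then have "(\<lambda>n. coord (shift x) (Suc n) *\<^sub>C u (Suc n)) sums M (D x)"
      by (simp add: u clinear_bddD(2)[OF M])
    then have "(\<lambda>n. coord (shift x) n *\<^sub>C u n) sums M (D x)"
      by (subst (asm) sums_Suc_iff) simp
    then show ?thesis by (rule sums_unique2[OF D(2)])
  qed
  have evR: "eval (R x) z = eval x z / (1 + r * z)" if z: "cmod z < 1" for x and z :: complex
  proof -
    have "eval (R x) z * (1 + r * z) = eval (R x + r *\<^sub>C shift (R x)) z"
      using z by (simp add: algebra_simps)
    then show ?thesis using one_plus_rz_nonzero[OF r z] by (simp add: R2 field_simps)
  qed
  have evu: "eval (u n) z = s / (1 + r * z) * phi r z ^ n" if z: "cmod z < 1" for n and z :: complex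
  proof (induction n)
    case 0
    show ?case using z by (simp add: u v_def evR)
  next
    case (Suc n)
    have "eval (M y) z = phi r z * eval y z" for y
      using z by (simp add: M_def evR phi_def distrib_right add_divide_distrib)
    then show ?case using Suc by (simp add: u)
  qed
  have evD: "eval (D x) z = s / (1 + r * z) * eval x (phi r z)" if z: "cmod z < 1" for x and z :: complex
  proof -
    have "(\<lambda>n. eval (coord x n *\<^sub>C u n) z) sums eval (D x) z"
      by (rule bounded_linear.sums[OF bounded_linear_eval D(2)])
    moreover have "(\<lambda>n. eval (coord x n *\<^sub>C u n) z) = (\<lambda>n. s / (1 + r * z) * (coord x n * phi r z ^ n))"
      by (simp add: evu[OF z] mult_ac)
    moreover have "(\<lambda>n. s / (1 + r * z) * (coord x n * phi r z ^ n)) sums (s / (1 + r * z) * eval x (phi r z))"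
      by (intro sums_mult eval_sums cmod_phi_less_1 r z)
    ultimately show ?thesis using sums_unique2 by simp
  qed
  show thesis
  proof (rule that[of "\<lambda>x. R (D x)"])
    show "clinear_bdd (\<lambda>x. R (D x))" by (rule clinear_bdd_compose[OF R(1) D(1)])
    show "eval (R (D x)) z = sqrt (1 - r\<^sup>2) / (1 + r * z)\<^sup>2 * eval x (phi r z)" if "cmod z < 1" for x and z :: complex
      using that by (simp add: evR evD s_def power2_eq_square)
    show "cinner (R (D x) + r *\<^sub>C shift (R (D x))) (R (D y) + r *\<^sub>C shift (R (D y))) = cinner x y" for x y
      by (simp only: R2 D(3))
    show "cinner (shift (R (D x)) + r *\<^sub>C R (D x)) (R (D y) + r *\<^sub>C shift (R (D y))) = cinner (shift x) y" for x y
      unfolding R2 M_def[symmetric] DS[symmetric] by (rule D(3))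
  qed
qed

text \<open>An affine function of t on [-n, n] is smallest at an end point; the last two hypotheses
  are the bounds at the two ends.\<close>

lemma linear_bound_on_interval:
  fixes p q t n :: real
  assumes "\<bar>t\<bar> \<le> n" "e * n \<le> p * n + q * n" "e * n \<le> p * n - q * n"
  shows "e * n \<le> p * n + q * t"
proof -
  have "- (\<bar>q\<bar> * n) \<le> q * t"
    using mult_left_mono[OF assms(1), of "\<bar>q\<bar>"] abs_mult[of q t] abs_ge_minus_self[of "q * t"] by linarith
  moreover have "\<bar>q\<bar> * n = q * n \<or> \<bar>q\<bar> * n = - (q * n)" by (cases "q \<ge> 0") auto
  ultimately show ?thesis using assms(2,3) by linarith
qed

text \<open>Lyapunov argument for the indefinite form \<open>Q x = - Re \<langle>shift x, x\<rangle>\<close>: with W = s k, both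
  \<open>Q (W x)\<close> and \<open>Q x\<close> are combinations of \<open>\<tau> = Re \<langle>shift (k x), k x\<rangle>\<close> and \<open>\<parallel>k x\<parallel>\<^sup>2\<close>, and
  \<open>Q (W x) - \<mu> Q x \<ge> e \<parallel>x\<parallel>\<^sup>2\<close> holds since it is affine in \<open>\<tau>\<close> and holds at \<open>\<tau> = \<plusminus>\<parallel>k x\<parallel>\<^sup>2\<close>;
  these two cases are the two bounds on \<open>\<mu> = \<bar>\<lambda>\<bar>\<^sup>2\<close>.\<close>

lemma weighted_composition_minus_bounded_below:
  fixes k :: "l2 \<Rightarrow> l2" and r :: real and l :: complex
  assumes r: "0 < r" "r < 1" and k: "clinear_bdd k"
    and k1: "\<And>x y. cinner (k x + r *\<^sub>C shift (k x)) (k y + r *\<^sub>C shift (k y)) = cinner x y"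
    and k2: "\<And>x y. cinner (shift (k x) + r *\<^sub>C k x) (k y + r *\<^sub>C shift (k y)) = cinner (shift x) y"
    and l: "(1 - r) / (1 + r) < (cmod l)\<^sup>2" "(cmod l)\<^sup>2 < (1 + r) / (1 - r)"
  obtains d where "d > 0" "\<And>x. d * norm x \<le> norm (sqrt (1 - r\<^sup>2) *\<^sub>C k x - l *\<^sub>C x)"
proof -
  define W where "W x = complex_of_real (sqrt (1 - r\<^sup>2)) *\<^sub>C k x" for x
  define m where "m = (cmod l)\<^sup>2"
  \<comment> \<open>Per unit of |k x|^2, \<open>p\<close> and \<open>q\<close> are the values of Q
    (W x) - m Q x at tau = -|k x|^2 and at tau = |k x|^2. In factored form each is visibly positive
    by one of the two bounds on |l|.\<close>
  define p where "p = (1 - r)\<^sup>2 * ((1 + r) / (1 - r) - m)"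
  define q where "q = (1 + r)\<^sup>2 * (m - (1 - r) / (1 + r))"
  define e where "e = min p q"
  have pq: "p = (1 - r) * (1 + r) - (1 - r)\<^sup>2 * m" "q = (1 + r)\<^sup>2 * m - (1 - r) * (1 + r)"
    using r unfolding p_def q_def by (simp_all add: power2_eq_square field_simps)
  have e: "e > 0" using l r unfolding e_def p_def q_def m_def by (auto intro!: mult_pos_pos)
  have r2: "1 - r\<^sup>2 > 0" using r by (simp add: power_less_one_iff)
  have SW: "Re (cinner (shift (W x)) (W x)) = (1 - r\<^sup>2) * Re (cinner (shift (k x)) (k x))" for x
  proof -
    define a where "a = sqrt (1 - r\<^sup>2)"
    have "Re (cinner (shift (W x)) (W x)) = a * a * Re (cinner (shift (k x)) (k x))"
      unfolding W_def a_def[symmetric] clinear_bddD(2)[OF clinear_bdd_shift] by simp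
    then show ?thesis using r2 by (simp add: a_def)
  qed
  have key: "e / (1 + r)\<^sup>2 * (norm x)\<^sup>2
      \<le> m * Re (cinner (shift x) x) - Re (cinner (shift (W x)) (W x))" for x
  proof -
    define t where "t = Re (cinner (shift (k x)) (k x))"
    define n where "n = (norm (k x))\<^sup>2"
    have t': "Re (cinner (k x) (shift (k x))) = t"
      unfolding t_def by (subst cinner_commute) simp
    have kk: "Re (cinner (k x) (k x)) = n" "Re (cinner (shift (k x)) (shift (k x))) = n"
      unfolding n_def by (simp_all add: cinner_self_norm)
    have "Re (cinner (shift x) x) = Re (cinner (shift (k x) + r *\<^sub>C k x) (k x + r *\<^sub>C shift (k x)))"
      by (simp only: k2)
    also have "\<dots> = (1 + r\<^sup>2) * t + 2 * r * n"
      by (simp add: cinner_simps t' kk power2_eq_square algebra_simps flip: t_def)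
    finally have Sx: "Re (cinner (shift x) x) = (1 + r\<^sup>2) * t + 2 * r * n" .
    have tn: "\<bar>t\<bar> \<le> n"
      using abs_Re_le_cmod[of "cinner (shift (k x)) (k x)"] cmod_cinner_le[of "shift (k x)" "k x"]
      unfolding t_def n_def power2_eq_square by simp
    have n0: "n \<ge> 0" by (simp add: n_def)
    have "e * n \<le> (2 * r * m) * n + ((1 + r\<^sup>2) * m - (1 - r\<^sup>2)) * t"
    proof (rule linear_bound_on_interval[OF tn])
      have "e * n \<le> q * n" "e * n \<le> p * n" using n0 by (auto simp: e_def intro: mult_right_mono)
      then show "e * n \<le> (2 * r * m) * n + ((1 + r\<^sup>2) * m - (1 - r\<^sup>2)) * n"
        "e * n \<le> (2 * r * m) * n - ((1 + r\<^sup>2) * m - (1 - r\<^sup>2)) * n"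
        unfolding pq by (simp_all add: power2_eq_square algebra_simps)
    qed
    also have "\<dots> = m * Re (cinner (shift x) x) - Re (cinner (shift (W x)) (W x))"
      unfolding SW Sx t_def[symmetric] by (simp add: algebra_simps)
    finally have *: "e * n \<le> m * Re (cinner (shift x) x) - Re (cinner (shift (W x)) (W x))" .
    \<comment> \<open>Passing from |k x| back to |x|: multiplication by 1 + r z after
      \<open>k\<close> is isometric and enlarges norms by at most the factor 1 + r.\<close>
    have "norm x = norm (k x + r *\<^sub>C shift (k x))"
      by (rule norm_eqI_cinner) (simp only: k1)
    also have "\<dots> \<le> norm (k x) + norm (r *\<^sub>C shift (k x))" by (rule norm_triangle_ineq)
    also have "\<dots> = (1 + r) * norm (k x)" using r by (simp add: algebra_simps)
    finally have "(norm x)\<^sup>2 \<le> ((1 + r) * norm (k x))\<^sup>2" by (intro power_mono) auto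
    then have "(norm x)\<^sup>2 \<le> n * (1 + r)\<^sup>2" unfolding n_def power_mult_distrib by (simp only: mult.commute)
    then have "(norm x)\<^sup>2 / (1 + r)\<^sup>2 \<le> n" using r by (simp add: pos_divide_le_eq)
    then have "e * ((norm x)\<^sup>2 / (1 + r)\<^sup>2) \<le> e * n" using e by (intro mult_left_mono) auto
    then show ?thesis using * by simp
  qed
  obtain KW where KW: "KW > 0" "\<And>x. norm (W x) \<le> KW * norm x"
    using clinear_bdd_pos_bound[OF clinear_bdd_cscale[OF k]] unfolding W_def by metis
  define e' where "e' = e / (1 + r)\<^sup>2"
  have e': "e' > 0" using e r by (simp add: e'_def)
  define C where "C = KW + cmod l"
  have C: "C > 0" using KW by (simp add: C_def add_pos_nonneg)
  have "e' / C * norm x \<le> norm (W x - l *\<^sub>C x)" for x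
  proof -
    \<comment> \<open>With \<open>W x = l *\<^sub>C x + h\<close>, Q (W x) differs from |l|^2 Q x
      only by terms containing h, of size at most C |x| |h|.\<close>
    define h where "h = W x - l *\<^sub>C x"
    have Wx: "W x = l *\<^sub>C x + h" by (simp add: h_def)
    have "cinner (shift (W x)) (W x) = l * cnj l * cinner (shift x) x
        + (l * cinner (shift x) h + cinner (shift h) (W x))"
      unfolding Wx clinear_bddD(3)[OF clinear_bdd_shift] clinear_bddD(2)[OF clinear_bdd_shift]
      by (simp add: cinner_simps algebra_simps)
    moreover have "l * cnj l = of_real m" unfolding m_def by (simp add: mult_cnj_cmod)
    ultimately have "Re (cinner (shift (W x)) (W x)) = m * Re (cinner (shift x) x)
        + Re (l * cinner (shift x) h + cinner (shift h) (W x))" by simp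
    then have "e' * (norm x)\<^sup>2 \<le> - Re (l * cinner (shift x) h + cinner (shift h) (W x))"
      using key[of x] unfolding e'_def by linarith
    also have "\<dots> \<le> cmod (l * cinner (shift x) h + cinner (shift h) (W x))"
      using abs_Re_le_cmod[of "l * cinner (shift x) h + cinner (shift h) (W x)"] by linarith
    also have "\<dots> \<le> cmod l * cmod (cinner (shift x) h) + cmod (cinner (shift h) (W x))"
      by (metis norm_mult norm_triangle_ineq)
    also have "\<dots> \<le> cmod l * (norm x * norm h) + norm h * (KW * norm x)"
      using cmod_cinner_le[of "shift x" h] cmod_cinner_le[of "shift h" "W x"]
        mult_left_mono[OF KW(2)[of x], of "norm h"]
      by (intro add_mono mult_left_mono) auto
    also have "\<dots> = (C * norm h) * norm x" by (simp add: C_def algebra_simps)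
    finally have "(e' * norm x) * norm x \<le> (C * norm h) * norm x" by (simp add: power2_eq_square mult_ac)
    then have "e' * norm x \<le> C * norm h" using C by (cases "norm x = 0") auto
    then show ?thesis using C by (simp add: h_def field_simps)
  qed
  moreover have "e' / C > 0" using e' C by simp
  ultimately show thesis using that unfolding W_def by blast
qed

section \<open>Orbit sums of kernels\<close>

text \<open>The Cayley transform w = (1 + x) / (1 - x) of (-1, 1) onto (0, \<infinity>) turns \<open>\<phi>\<^sub>r\<close> into division by
  a = (1 - r) / (1 + r). The weight of \<open>orbit_kern w\<close> is \<open>1 - x\<^sup>2\<close>.\<close>

definition cay :: "real \<Rightarrow> real" where "cay w = (w - 1) / (w + 1)"

definition orbit_kern :: "real \<Rightarrow> l2" where
  "orbit_kern w = complex_of_real (4 * w / (w + 1)\<^sup>2) *\<^sub>C kern (cay w)"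

lemma one_minus_cay_sq: "w > 0 \<Longrightarrow> 1 - (cay w)\<^sup>2 = 4 * w / (w + 1)\<^sup>2"
proof -
  assume w: "w > 0"
  then have cw: "cay w * (w + 1) = w - 1" by (simp add: cay_def)
  have "(w + 1)\<^sup>2 - (cay w * (w + 1))\<^sup>2 = 4 * w"
    unfolding cw by (simp add: power2_eq_square algebra_simps)
  then have "(1 - (cay w)\<^sup>2) * (w + 1)\<^sup>2 = 4 * w"
    unfolding power_mult_distrib by (simp add: left_diff_distrib)
  then show ?thesis using w by (simp add: eq_divide_eq)
qed

lemma abs_cay_less_1: "w > 0 \<Longrightarrow> \<bar>cay w\<bar> < 1"
  by (simp add: cay_def field_simps)

lemma cay_eq_iff: "v > 0 \<Longrightarrow> w > 0 \<Longrightarrow> cay v = cay w \<longleftrightarrow> v = w"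
  by (simp add: cay_def field_simps)

lemma norm_orbit_kern:
  assumes w: "w > 0" shows "norm (orbit_kern w) = sqrt (4 * w / (w + 1)\<^sup>2)"
proof -
  define c where "c = 4 * w / (w + 1)\<^sup>2"
  have c: "c > 0" using w by (simp add: c_def)
  have "(norm (kern (cay w)))\<^sup>2 = 1 / c"
    using norm_kern[of "cay w"] abs_cay_less_1[OF w] one_minus_cay_sq[OF w] by (simp add: c_def)
  moreover have "(norm (orbit_kern w))\<^sup>2 = c\<^sup>2 * (norm (kern (cay w)))\<^sup>2"
    unfolding orbit_kern_def c_def[symmetric] using c by (simp add: power_mult_distrib)
  ultimately have "(norm (orbit_kern w))\<^sup>2 = c" using c by (simp add: power2_eq_square)
  then show ?thesis by (simp add: c_def real_sqrt_unique)
qed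

text \<open>One bound for each end of an orbit: the first decays as w tends to 0, that is x to -1,
  the second as w tends to infinity, that is x to 1.\<close>

lemma norm_orbit_kern_le:
  assumes w: "w > 0"
  shows "norm (orbit_kern w) \<le> 2 * sqrt w" "norm (orbit_kern w) \<le> 2 / sqrt w"
proof -
  have e: "norm (orbit_kern w) = 2 * sqrt w / (w + 1)"
    unfolding norm_orbit_kern[OF w] using w by (simp add: real_sqrt_mult real_sqrt_divide)
  show "norm (orbit_kern w) \<le> 2 * sqrt w"
    unfolding e using w by (simp add: divide_le_eq mult_le_cancel_left1)
  have "2 * sqrt w / (w + 1) \<le> 2 * (sqrt w / w)" using w by (simp add: frac_le)
  also have "\<dots> = 2 / sqrt w" using w by (simp add: sqrt_divide_self_eq inverse_eq_divide)
  finally show "norm (orbit_kern w) \<le> 2 / sqrt w" unfolding e .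
qed

text \<open>The adjoint takes the kernel at a real x to phi'(x) times the kernel at phi(x). Since
  phi'(x) = (1 - phi(x)^2)/(1 - x^2), the weight 1 - x^2 absorbs this factor.\<close>

lemma adjoint_orbit_kern:
  fixes r :: real
  assumes r: "0 < r" "r < 1"
    and W: "\<And>x (z::complex). cmod z < 1 \<Longrightarrow> eval (W x) z = (1 - r\<^sup>2) / (1 + r * z)\<^sup>2 * eval x (phi r z)"
    and adj: "\<And>x y. cinner (W x) y = cinner x (Ws y)"
    and Ws: "clinear_bdd Ws" and w: "w > 0"
  shows "Ws (orbit_kern w) = orbit_kern (w / ((1 - r) / (1 + r)))"
proof (rule cinner_eqI)
  fix x
  define a where "a = (1 - r) / (1 + r)"
  have a: "a > 0" using r by (simp add: a_def)
  define D where "D = w * (1 + r) + (1 - r)"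
  have D: "D > 0" using r w by (simp add: D_def add_pos_pos)
  have wa: "w / a + 1 = D / (1 - r)" "w / a - 1 = (w * (1 + r) - (1 - r)) / (1 - r)"
    using r by (simp_all add: a_def D_def field_simps)
  have c1: "1 + r * cay w = D / (w + 1)" using w by (simp add: cay_def D_def field_simps)
  have c2: "cay w + r = (w * (1 + r) - (1 - r)) / (w + 1)" using w by (simp add: cay_def field_simps)
  have ph: "phi r (cay w) = cay (w / a)"
  proof -
    have "phi r (cay w) = complex_of_real ((cay w + r) / (1 + r * cay w))" by (simp add: phi_def)
    also have "(cay w + r) / (1 + r * cay w) = cay (w / a)"
      unfolding c1 c2 unfolding cay_def wa using r w D by simp
    finally show ?thesis .
  qed
  have wt: "4 * w / (w + 1)\<^sup>2 * ((1 - r\<^sup>2) / (1 + r * cay w)\<^sup>2) = 4 * (w / a) / (w / a + 1)\<^sup>2"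
  proof -
    have "4 * w / (w + 1)\<^sup>2 * ((1 - r\<^sup>2) / (1 + r * cay w)\<^sup>2) = 4 * w * (1 - r\<^sup>2) / D\<^sup>2"
      unfolding c1 using w D by (simp add: power_divide)
    also have "\<dots> = 4 * (w / a) / (w / a + 1)\<^sup>2"
      unfolding wa power_divide using r D by (simp add: a_def power2_eq_square field_simps)
    finally show ?thesis .
  qed
  have "cinner x (Ws (orbit_kern w)) = 4 * w / (w + 1)\<^sup>2 * eval (W x) (cay w)"
    unfolding adj[symmetric] orbit_kern_def eval_def by simp
  also have "\<dots> = complex_of_real (4 * w / (w + 1)\<^sup>2 * ((1 - r\<^sup>2) / (1 + r * cay w)\<^sup>2)) * eval x (phi r (cay w))"
    using W[of "cay w" x] abs_cay_less_1[OF w] by simp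
  also have "\<dots> = cinner x (orbit_kern (w / a))"
    unfolding wt ph orbit_kern_def eval_def by simp
  finally show "cinner x (Ws (orbit_kern w)) = cinner x (orbit_kern (w / a))" .
qed

text \<open>The norms decay like the powers of sqrt a at both ends, so the geometric ratios are sqrt
  a / |l| and |l| sqrt a: each bound on |l| serves one end.\<close>

lemma orbit_kern_summable:
  fixes a :: real and l :: complex
  assumes a: "0 < a" and l: "sqrt a < cmod l" "cmod l < 1 / sqrt a" and w: "w > 0"
  shows "summable (\<lambda>k. norm ((1 / cnj l) ^ k *\<^sub>C orbit_kern (w / a ^ k)))"
    "summable (\<lambda>k. norm (cnj l ^ k *\<^sub>C orbit_kern (w * a ^ k)))"
proof -
  have sa: "sqrt a > 0" using a by simp
  then have l0: "cmod l > 0" using l(1) by linarith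
  have "cmod l * sqrt a < 1" using l(2) sa by (simp add: pos_less_divide_eq)
  show "summable (\<lambda>k. norm ((1 / cnj l) ^ k *\<^sub>C orbit_kern (w / a ^ k)))"
  proof (rule summable_comparison_test')
    show "summable (\<lambda>k. 2 / sqrt w * (sqrt a / cmod l) ^ k)"
      using l sa l0 by (intro summable_mult summable_geometric) simp
    fix k
    have "norm (orbit_kern (w / a ^ k)) \<le> 2 / sqrt (w / a ^ k)"
      using w a by (intro norm_orbit_kern_le) simp
    also have "\<dots> = 2 / sqrt w * sqrt a ^ k" by (simp add: real_sqrt_divide real_sqrt_power)
    finally have "(1 / cmod l) ^ k * norm (orbit_kern (w / a ^ k)) \<le> (1 / cmod l) ^ k * (2 / sqrt w * sqrt a ^ k)"
      by (intro mult_left_mono) auto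
    then show "norm (norm ((1 / cnj l) ^ k *\<^sub>C orbit_kern (w / a ^ k))) \<le> 2 / sqrt w * (sqrt a / cmod l) ^ k"
      by (simp add: norm_power norm_divide power_divide mult_ac)
  qed
  show "summable (\<lambda>k. norm (cnj l ^ k *\<^sub>C orbit_kern (w * a ^ k)))"
  proof (rule summable_comparison_test')
    show "summable (\<lambda>k. 2 * sqrt w * (cmod l * sqrt a) ^ k)"
      using \<open>cmod l * sqrt a < 1\<close> sa l0 by (intro summable_mult summable_geometric) simp
    fix k
    have "norm (orbit_kern (w * a ^ k)) \<le> 2 * sqrt (w * a ^ k)"
      using w a by (intro norm_orbit_kern_le) simp
    also have "\<dots> = 2 * sqrt w * sqrt a ^ k" by (simp add: real_sqrt_mult real_sqrt_power)
    finally have "cmod l ^ k * norm (orbit_kern (w * a ^ k)) \<le> cmod l ^ k * (2 * sqrt w * sqrt a ^ k)"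
      by (intro mult_left_mono) auto
    then show "norm (norm (cnj l ^ k *\<^sub>C orbit_kern (w * a ^ k))) \<le> 2 * sqrt w * (cmod l * sqrt a) ^ k"
      by (simp add: norm_power power_mult_distrib mult_ac)
  qed
qed

text \<open>The sum over the two-sided orbit; its k = 0 term is contained in the first series only.\<close>

definition orbit_sum :: "real \<Rightarrow> complex \<Rightarrow> real \<Rightarrow> l2" where
  "orbit_sum a l w = (\<Sum>k. (1 / cnj l) ^ k *\<^sub>C orbit_kern (w / a ^ k))
     + (\<Sum>k. cnj l ^ Suc k *\<^sub>C orbit_kern (w * a ^ Suc k))"

lemma adjoint_orbit_sum:
  assumes a: "0 < a" and l: "sqrt a < cmod l" "cmod l < 1 / sqrt a" and w: "w > 0"
    and Ws: "clinear_bdd Ws" "\<And>w. w > 0 \<Longrightarrow> Ws (orbit_kern w) = orbit_kern (w / a)"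
  shows "Ws (orbit_sum a l w) = cnj l *\<^sub>C orbit_sum a l w"
proof -
  define p where "p k = (1 / cnj l) ^ k *\<^sub>C orbit_kern (w / a ^ k)" for k
  define n where "n k = cnj l ^ k *\<^sub>C orbit_kern (w * a ^ k)" for k
  have l0: "l \<noteq> 0" using l(1) a by (metis less_le_not_le norm_zero real_sqrt_ge_0_iff less_imp_le)
  have sp: "summable p" and sn: "summable n"
    using orbit_kern_summable[OF a l w] unfolding p_def[symmetric] n_def[symmetric]
    by (auto intro: summable_norm_cancel)
  have sn': "summable (\<lambda>k. n (Suc k))" using sn by (simp add: summable_Suc_iff)
  have m: "orbit_sum a l w = suminf p + (\<Sum>k. n (Suc k))"
    unfolding orbit_sum_def p_def n_def ..
  have Wp: "Ws (p k) = cnj l *\<^sub>C p (Suc k)" for k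
    using l0 w a by (simp add: p_def clinear_bddD(2)[OF Ws(1)] Ws(2) mult.commute)
  have Wn: "Ws (n (Suc k)) = cnj l *\<^sub>C n k" for k
    using w a by (simp add: n_def clinear_bddD(2)[OF Ws(1)] Ws(2))
  have "Ws (suminf p) = (\<Sum>k. cnj l *\<^sub>C p (Suc k))"
    unfolding bounded_linear.suminf[OF clinear_bddD(1)[OF Ws(1)] sp] Wp ..
  also have "\<dots> = cnj l *\<^sub>C (\<Sum>k. p (Suc k))"
    using sp by (intro bounded_linear.suminf[OF bounded_linear_cscale, symmetric]) (simp add: summable_Suc_iff)
  finally have 1: "Ws (suminf p) = cnj l *\<^sub>C (suminf p - p 0)"
    by (simp add: suminf_split_head[OF sp])
  have "Ws (\<Sum>k. n (Suc k)) = (\<Sum>k. cnj l *\<^sub>C n k)"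
    unfolding bounded_linear.suminf[OF clinear_bddD(1)[OF Ws(1)] sn'] Wn ..
  also have "\<dots> = cnj l *\<^sub>C suminf n"
    by (rule bounded_linear.suminf[OF bounded_linear_cscale sn, symmetric])
  also have "suminf n = (\<Sum>k. n (Suc k)) + n 0"
    by (simp add: suminf_split_head[OF sn])
  finally have 2: "Ws (\<Sum>k. n (Suc k)) = cnj l *\<^sub>C ((\<Sum>k. n (Suc k)) + n 0)" .
  \<comment> \<open>The adjoint moves every term one place along the orbit. The term
    \<open>p 0\<close> lost by the first series is the term \<open>n 0\<close> gained by the
    second.\<close>
  have "p 0 = n 0" by (simp add: p_def n_def)
  then show ?thesis
    unfolding m clinear_bddD(3)[OF Ws(1)] 1 2 by (simp add: cscale_distribs)
qed

text \<open>Multiplication by the polynomial is assembled from \<open>shift\<close> and iterated on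
  the constant 1. For real y in (-1, 1) its values on (-1, 1) lie in [0, 1] and equal 1 only at y;
  the divisor 4 is the squared length of that interval.\<close>

lemma peak_vectors_exist:
  obtains g where "\<And>N (z::complex). cmod z < 1 \<Longrightarrow> eval (g N) z = (1 - (z - y)\<^sup>2 / 4) ^ N"
proof -
  define s where "s x = x - (1/4) *\<^sub>C (shift (shift x) - (2 * y) *\<^sub>C shift x + y\<^sup>2 *\<^sub>C x)" for x
  have s: "eval (s x) z = (1 - (z - y)\<^sup>2 / 4) * eval x z" if "cmod z < 1" for x and z :: complex
    using that by (simp add: s_def power2_eq_square field_simps)
  have "eval ((s ^^ N) (unit_vec 0)) z = (1 - (z - y)\<^sup>2 / 4) ^ N" if "cmod z < 1" for N and z :: complex
    using that by (induction N) (simp_all add: s)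
  then show thesis by (rule that)
qed

text \<open>Testing against the peak polynomials \<open>(1 - (z - cay v)\<^sup>2/4)\<^sup>N\<close> isolates, by dominated convergence,
  the term of the orbit sum at the point cay v.\<close>

lemma orbit_sum_peak_limit:
  fixes a :: real and l :: complex
  assumes a: "0 < a" "a < 1" and l: "sqrt a < cmod l" "cmod l < 1 / sqrt a"
    and w: "a < w" "w < 1" and v: "a < v" "v < 1"
    and g: "\<And>N (z::complex). cmod z < 1 \<Longrightarrow> eval (g N) z = (1 - (z - of_real (cay v))\<^sup>2 / 4) ^ N"
  shows "(\<lambda>N. cinner (g N) (orbit_sum a l w)) \<longlonglongrightarrow> (if w = v then of_real (4 * v / (v + 1)\<^sup>2) else 0)"
proof -
  define b where "b x = 1 - (x - cay v)\<^sup>2 / 4" for x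
  define c where "c u = 4 * u / (u + 1)\<^sup>2" for u :: real
  have v0: "v > 0" and w0: "w > 0" using v w a by auto
  have b: "0 \<le> b (cay u)" "b (cay u) \<le> 1" "b (cay u) = 1 \<longleftrightarrow> u = v" if "u > 0" for u
  proof -
    have "\<bar>cay u - cay v\<bar> < 2" using abs_cay_less_1[OF that] abs_cay_less_1[OF v0] by linarith
    then have "(cay u - cay v)\<^sup>2 \<le> 2\<^sup>2" by (intro abs_le_square_iff[THEN iffD1]) simp
    then show "0 \<le> b (cay u)" "b (cay u) \<le> 1" by (simp_all add: b_def)
    show "b (cay u) = 1 \<longleftrightarrow> u = v" using cay_eq_iff[OF that v0] by (simp add: b_def)
  qed
  have ev: "cinner (g N) (d *\<^sub>C orbit_kern u) = cnj d * of_real (c u) * of_real (b (cay u)) ^ N"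
    if "u > 0" for N d u
  proof -
    have "eval (g N) (cay u) = (1 - (complex_of_real (cay u) - of_real (cay v))\<^sup>2 / 4) ^ N"
      by (rule g) (simp add: abs_cay_less_1[OF that])
    then show ?thesis by (simp add: orbit_kern_def c_def b_def eval_def)
  qed
  have lim1: "(\<lambda>N. cinner (g N) (d *\<^sub>C orbit_kern u)) \<longlonglongrightarrow> (if u = v then cnj d * of_real (c u) else 0)"
    if "u > 0" for d u
  proof -
    have "(\<lambda>N. of_real (b (cay u)) ^ N) \<longlonglongrightarrow> (if u = v then 1 else 0 :: complex)"
      using b[OF that] by (cases "u = v") (auto intro!: LIMSEQ_power_zero)
    from tendsto_mult_left[OF this, of "cnj d * of_real (c u)"] show ?thesis
      unfolding ev[OF that] by (simp add: if_distrib cong: if_cong)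
  qed
  \<comment> \<open>The domination for Tannery's theorem, uniform in N. It rests on the values of
    the peak polynomials at real points, not on the norm of \<open>g N\<close>: these values are at
    most 1, and \<open>c u\<close> is at most its root, the norm of
    \<open>orbit_kern u\<close>.\<close>
  have le: "norm (cinner (g N) (d *\<^sub>C orbit_kern u)) \<le> norm (d *\<^sub>C orbit_kern u)" if "u > 0" for d u N
  proof -
    have c: "0 \<le> c u" "c u \<le> 1"
      using that zero_le_power2[of "cay u"] one_minus_cay_sq[OF that, folded c_def] by (simp add: c_def, linarith)
    have "c u * c u \<le> c u" using c by (simp add: mult_left_le)
    then have "c u \<le> sqrt (c u)" using c by (simp add: real_le_rsqrt power2_eq_square)
    moreover have "b (cay u) ^ N \<le> 1" using b[OF that] by (simp add: power_le_one)
    ultimately have "c u * b (cay u) ^ N \<le> sqrt (c u) * 1"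
      using c b[OF that] by (intro mult_mono) auto
    then have "cmod d * (c u * b (cay u) ^ N) \<le> cmod d * sqrt (c u)" by (intro mult_left_mono) auto
    then show ?thesis
      using c b[OF that] unfolding ev[OF that] norm_cscale norm_orbit_kern[OF that] c_def[symmetric]
      by (simp add: norm_mult norm_power mult.assoc)
  qed
  have tannery: "(\<lambda>N. cinner (g N) (\<Sum>k. d k *\<^sub>C orbit_kern (u k)))
      \<longlonglongrightarrow> (\<Sum>k. if u k = v then cnj (d k) * of_real (c (u k)) else 0)"
    if u: "\<And>k. u k > 0" and s: "summable (\<lambda>k. norm (d k *\<^sub>C orbit_kern (u k)))" for d u
  proof -
    have "cinner (g N) (\<Sum>k. d k *\<^sub>C orbit_kern (u k)) = (\<Sum>k. cinner (g N) (d k *\<^sub>C orbit_kern (u k)))" for N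
      by (rule bounded_linear.suminf[OF bounded_linear_cinner_right summable_norm_cancel[OF s]])
    moreover have "(\<lambda>N. \<Sum>k. cinner (g N) (d k *\<^sub>C orbit_kern (u k)))
      \<longlonglongrightarrow> (\<Sum>k. if u k = v then cnj (d k) * of_real (c (u k)) else 0)"
      by (intro tannerys_theorem[THEN conjunct2, THEN conjunct2] lim1 u s)
        (auto intro!: always_eventually le u s simp del: norm_cscale cinner_cscale_right)
    ultimately show ?thesis by simp
  qed
  \<comment> \<open>An orbit of division by a meets (a, 1) at most once, so only the term k = 0 can
    sit at v.\<close>
  have u1: "w / a ^ k = v \<longleftrightarrow> k = 0 \<and> w = v" for k
  proof (cases k)
    case (Suc j)
    have "a ^ k \<le> a ^ 1" using a Suc by (intro power_decreasing) auto
    then have "v * a ^ k < 1 * a" using a v by (intro mult_less_le_imp_less) auto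
    then have "v * a ^ k \<noteq> w" using w by simp
    then show ?thesis using a Suc by (auto simp: field_simps)
  qed auto
  have u2: "w * a ^ Suc k \<noteq> v" for k
  proof -
    have "a ^ Suc k \<le> a ^ 1" using a by (intro power_decreasing) auto
    then have "w * a ^ Suc k < 1 * a" using a w by (intro mult_less_le_imp_less) auto
    then show ?thesis using v by simp
  qed
  note s = orbit_kern_summable[OF a(1) l w0]
  have s2: "summable (\<lambda>k. norm (cnj l ^ Suc k *\<^sub>C orbit_kern (w * a ^ Suc k)))"
    using s(2) by (subst summable_Suc_iff)
  have t1: "(\<lambda>N. cinner (g N) (\<Sum>k. (1 / cnj l) ^ k *\<^sub>C orbit_kern (w / a ^ k)))
      \<longlonglongrightarrow> (if w = v then of_real (c v) else 0)"
  proof -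
    have eq: "(\<lambda>k. if w / a ^ k = v then cnj ((1 / cnj l) ^ k) * of_real (c (w / a ^ k)) else 0)
        = (\<lambda>k. if k = 0 then (if w = v then of_real (c v) else 0) else (0 :: complex))"
      unfolding u1 by auto
    have "(\<Sum>k. if k = 0 then (if w = v then of_real (c v) else 0) else (0 :: complex))
        = (if w = v then of_real (c v) else 0)"
      by (subst suminf_finite[of "{0}"]) auto
    then show ?thesis
      using tannery[of "\<lambda>k. w / a ^ k" "\<lambda>k. (1 / cnj l) ^ k"] w0 a s(1) unfolding eq by simp
  qed
  have t2: "(\<lambda>N. cinner (g N) (\<Sum>k. cnj l ^ Suc k *\<^sub>C orbit_kern (w * a ^ Suc k))) \<longlonglongrightarrow> 0"
    using tannery[of "\<lambda>k. w * a ^ Suc k" "\<lambda>k. cnj l ^ Suc k", OF _ s2] w0 a u2 by simp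
  show ?thesis
    using tendsto_add[OF t1 t2] unfolding orbit_sum_def cinner_simps c_def by simp
qed

text \<open>Points of (a, 1) lie on pairwise different orbits. Pairing a linear relation with the
  peak vectors at v and letting N grow leaves only the coefficient at v, so these infinitely many
  orbit sums are independent.\<close>

lemma orbit_sums_infinite_dim:
  fixes a :: real and l :: complex
  assumes a: "0 < a" "a < 1" and l: "sqrt a < cmod l" "cmod l < 1 / sqrt a"
    and S: "\<And>w. w > 0 \<Longrightarrow> orbit_sum a l w \<in> S"
  shows "\<nexists>G. finite G \<and> S \<subseteq> span G"
proof
  assume "\<exists>G. finite G \<and> S \<subseteq> span G"
  then obtain G where G: "finite G" "S \<subseteq> span G" by blast
  let ?m = "orbit_sum a l"
  have zero: "u v = 0"
    if F: "finite F" "F \<subseteq> {a<..<1}" "(\<Sum>w\<in>F. u w *\<^sub>R ?m w) = 0" and v: "v \<in> F" for F u v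
  proof -
    obtain g where g: "\<And>N (z::complex). cmod z < 1 \<Longrightarrow>
        eval (g N) z = (1 - (z - complex_of_real (cay v))\<^sup>2 / 4) ^ N"
      using peak_vectors_exist[of "complex_of_real (cay v)"] by blast
    have lim: "(\<lambda>N. cinner (g N) (?m w)) \<longlonglongrightarrow> (if w = v then of_real (4 * v / (v + 1)\<^sup>2) else 0)" if "w \<in> F" for w
      using F(2) that v by (intro orbit_sum_peak_limit a l g) auto
    have "(\<lambda>N. \<Sum>w\<in>F. of_real (u w) * cinner (g N) (?m w))
        \<longlonglongrightarrow> (\<Sum>w\<in>F. of_real (u w) * (if w = v then of_real (4 * v / (v + 1)\<^sup>2) else 0))"
      by (intro tendsto_intros lim)
    moreover have "(\<Sum>w\<in>F. of_real (u w) * cinner (g N) (?m w)) = 0" for N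
    proof -
      have "(\<Sum>w\<in>F. of_real (u w) * cinner (g N) (?m w)) = cinner (g N) (\<Sum>w\<in>F. u w *\<^sub>R ?m w)"
        by (subst linear_sum[OF bounded_linear.linear[OF bounded_linear_cinner_right]])
          (simp add: scaleR_cscale)
      then show ?thesis unfolding F(3) by simp
    qed
    ultimately have "(\<Sum>w\<in>F. of_real (u w) * (if w = v then of_real (4 * v / (v + 1)\<^sup>2) else 0)) = (0::complex)"
      using LIMSEQ_unique[OF _ tendsto_const] by simp
    then have "complex_of_real (u v * (4 * v / (v + 1)\<^sup>2)) = 0"
      using F(1) v by (simp add: if_distrib cong: if_cong)
    then have "u v * (4 * v / (v + 1)\<^sup>2) = 0" by (simp only: of_real_eq_0_iff)
    moreover have "v > 0" using v F(2) a by auto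
    ultimately show ?thesis by (simp add: add_pos_pos less_imp_neq[symmetric])
  qed
  have inj: "inj_on ?m {a<..<1}"
  proof (rule inj_onI, rule ccontr)
    fix v w assume vw: "v \<in> {a<..<1}" "w \<in> {a<..<1}" "?m v = ?m w" "v \<noteq> w"
    have "(1::real) = 0"
      using zero[of "{v, w}" "\<lambda>x. if x = v then 1 else -1" v] vw by simp
    then show False by simp
  qed
  have "independent (?m ` {a<..<1})"
    unfolding independent_explicit_finite_subsets
  proof (intro allI impI ballI)
    fix T u x assume T: "T \<subseteq> ?m ` {a<..<1}" "finite T" "(\<Sum>v\<in>T. u v *\<^sub>R v) = 0" and x: "x \<in> T"
    obtain F where F: "F \<subseteq> {a<..<1}" "T = ?m ` F" using T(1) by (meson subset_imageE)
    have injF: "inj_on ?m F" using inj F(1) by (rule inj_on_subset)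
    have "finite F" using T(2) F(2) injF by (simp add: finite_image_iff)
    moreover have "(\<Sum>w\<in>F. u (?m w) *\<^sub>R ?m w) = 0"
      using T(3) unfolding F(2) by (simp add: sum.reindex[OF injF])
    ultimately show "u x = 0"
      using zero[of F "\<lambda>w. u (?m w)"] F x by auto
  qed
  moreover have "?m ` {a<..<1} \<subseteq> span G" using S G(2) a by auto
  ultimately have "finite (?m ` {a<..<1})" using independent_span_bound[OF G(1)] by blast
  then have "finite {a<..<1}" using inj by (simp add: finite_image_iff)
  then show False using a by (simp add: infinite_Ioo)
qed

section \<open>The space S2 in coordinates\<close>

lemma taylor_coeff_eqI:
  assumes "\<And>z. cmod z < 1 \<Longrightarrow> (\<lambda>n. b n * z ^ n) sums g z"
  shows "taylor_coeff g n = b n"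
proof -
  have "\<forall>\<^sub>F z in nhds 0. (\<lambda>n. fps_nth (Abs_fps b) n * z ^ n) sums g z"
    unfolding eventually_nhds using assms
    by (intro exI[of _ "ball 0 1"]) auto
  then have "g has_fps_expansion Abs_fps b" by (rule has_fps_expansionI)
  from fps_nth_fps_expansion[OF this, of n] show ?thesis by (simp add: taylor_coeff_def)
qed

lemma eval_holomorphic: "(\<lambda>z. eval x z) holomorphic_on ball 0 1"
  by (rule power_series_holomorphic[of 0 1 "coord x"]) (simp add: eval_sums)

lemma eval_has_field_derivative:
  assumes z: "cmod z < 1"
    and y: "\<And>n. coord y n = of_nat (Suc n) * coord x (Suc n)"
  shows "(eval x has_field_derivative eval y z) (at z)"
proof -
  define K where "K = complex_of_real ((1 + cmod z) / 2)"
  have "cmod K = (1 + cmod z) / 2" unfolding K_def norm_of_real by simp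
  then have K: "cmod K < 1" "cmod z < cmod K" using z by simp_all
  have "((\<lambda>w. \<Sum>n. coord x n * w ^ n) has_field_derivative (\<Sum>n. diffs (coord x) n * z ^ n)) (at z)"
    by (rule termdiffs_strong[OF sums_summable[OF eval_sums[OF K(1)]] K(2)])
  moreover have "(\<Sum>n. diffs (coord x) n * z ^ n) = eval y z"
    using eval_sums[OF z, of y] by (simp add: diffs_def y sums_iff)
  ultimately have "((\<lambda>w. \<Sum>n. coord x n * w ^ n) has_field_derivative eval y z) (at z)" by simp
  then show ?thesis
    by (rule has_field_derivative_transform_within_open[of _ _ _ "ball 0 1"])
      (use z eval_sums in \<open>auto simp: sums_iff\<close>)
qed

text \<open>With f(0) at index 0 and the coefficients of f' after it, the inner product of
  \<open>S2\<close> is exactly \<open>cinner\<close>, and \<open>unshift (s2_seq f)\<close> is f' as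
  an element of the Hardy space.\<close>

definition s2_seq :: "(complex \<Rightarrow> complex) \<Rightarrow> l2" where
  "s2_seq f = Abs_l2 (\<lambda>n. case n of 0 \<Rightarrow> f 0 | Suc m \<Rightarrow> taylor_coeff (deriv f) m)"

lemma coord_s2_seq:
  assumes "f \<in> S2"
  shows "coord (s2_seq f) 0 = f 0" "coord (s2_seq f) (Suc n) = taylor_coeff (deriv f) n"
proof -
  have "summable (\<lambda>n. (cmod (taylor_coeff (deriv f) n))\<^sup>2)"
    using assms by (simp add: S2_def H2_def)
  then have "summable (\<lambda>n. (cmod (case n of 0 \<Rightarrow> f 0 | Suc m \<Rightarrow> taylor_coeff (deriv f) m))\<^sup>2)"
    by (subst summable_Suc_iff[symmetric]) simp
  then show "coord (s2_seq f) 0 = f 0" "coord (s2_seq f) (Suc n) = taylor_coeff (deriv f) n"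
    by (simp_all add: s2_seq_def coord_Abs_l2)
qed

text \<open>The entrance to \<open>S2\<close>, for \<open>s2_fun\<close> and \<open>comp_op\<close>
  alike: one derivative formula on the disc yields both membership and coordinates.\<close>

lemma S2I_eval_deriv:
  assumes zero: "\<And>z. \<not> cmod z < 1 \<Longrightarrow> f z = 0"
    and der: "\<And>z. cmod z < 1 \<Longrightarrow> (f has_field_derivative eval y z) (at z)"
  shows "f \<in> S2" "unshift (s2_seq f) = y"
proof -
  have d: "deriv f z = eval y z" if "cmod z < 1" for z
    using der[OF that] by (rule DERIV_imp_deriv)
  have t: "taylor_coeff (deriv f) n = coord y n" for n
    by (rule taylor_coeff_eqI) (simp add: d eval_sums)
  have "f holomorphic_on ball 0 1"
    by (auto simp: holomorphic_on_open intro!: exI der)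
  moreover have "deriv f holomorphic_on ball 0 1"
    using eval_holomorphic[of y] by (rule holomorphic_transform) (simp add: d)
  ultimately show f: "f \<in> S2"
    unfolding S2_def H2_def using zero by (auto simp: t summable_coord_sq)
  show "unshift (s2_seq f) = y"
    by (rule l2_eqI) (simp add: coord_s2_seq[OF f] t)
qed

lemma S2_has_field_derivative:
  assumes f: "f \<in> S2" and z: "cmod z < 1"
  shows "(f has_field_derivative eval (unshift (s2_seq f)) z) (at z)"
proof -
  have h: "f holomorphic_on ball 0 1" "deriv f holomorphic_on ball 0 1"
    using f by (auto simp: S2_def H2_def)
  have "(\<lambda>n. taylor_coeff (deriv f) n * z ^ n) sums deriv f z"
    using holomorphic_power_series[OF h(2), of z] z by (simp add: taylor_coeff_def)
  then have "deriv f z = eval (unshift (s2_seq f)) z"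
    using eval_sums[OF z, of "unshift (s2_seq f)"] sums_unique2 by (simp add: coord_s2_seq[OF f])
  moreover have "(f has_field_derivative deriv f z) (at z)"
    using h(1) z by (intro holomorphic_derivI[of f "ball 0 1"]) auto
  ultimately show ?thesis by simp
qed

text \<open>The termwise primitive: division by max n 1 leaves the constant coefficient alone.\<close>

definition integ :: "l2 \<Rightarrow> l2" where "integ x = Abs_l2 (\<lambda>n. coord x n / of_nat (max n 1))"

definition s2_fun :: "l2 \<Rightarrow> complex \<Rightarrow> complex" where
  "s2_fun x z = (if cmod z < 1 then eval (integ x) z else 0)"

lemma cmod_integ_le: "(cmod (coord x n / of_nat (max n 1)))\<^sup>2 \<le> (cmod (coord x n))\<^sup>2"
proof (rule power_mono)
  have "cmod (coord x n) / real (max n 1) \<le> cmod (coord x n) / 1"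
    by (rule divide_left_mono) auto
  then show "cmod (coord x n / of_nat (max n 1)) \<le> cmod (coord x n)" by (simp add: norm_divide)
qed simp

lemma coord_integ: "coord (integ x) n = coord x n / of_nat (max n 1)"
  unfolding integ_def
proof (rule coord_Abs_l2)
  show "summable (\<lambda>n. (cmod (coord x n / of_nat (max n 1)))\<^sup>2)"
    by (rule summable_comparison_test'[OF summable_coord_sq[of x]]) (simp only: real_norm_def abs_of_nonneg zero_le_power2 cmod_integ_le)
qed

lemma clinear_bdd_integ: "clinear_bdd integ"
proof (rule clinear_bddI[of _ 1])
  fix x y c
  show "integ (x + y) = integ x + integ y" "integ (c *\<^sub>C x) = c *\<^sub>C integ x"
    by (auto intro!: l2_eqI simp: coord_integ add_divide_distrib)
  have "(norm (integ x))\<^sup>2 \<le> (norm x)\<^sup>2"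
    unfolding norm_l2_sq
    by (intro suminf_le summable_coord_sq) (simp only: coord_integ cmod_integ_le)
  then show "norm (integ x) \<le> 1 * norm x" by simp
qed

lemma s2_fun_has_field_derivative:
  assumes "cmod z < 1"
  shows "(s2_fun x has_field_derivative eval (unshift x) z) (at z)"
proof -
  have "(eval (integ x) has_field_derivative eval (unshift x) z) (at z)"
    by (rule eval_has_field_derivative[OF assms]) (simp add: coord_integ del: of_nat_Suc)
  then show ?thesis
    by (rule has_field_derivative_transform_within_open[of _ _ _ "ball 0 1"])
      (use assms in \<open>auto simp: s2_fun_def\<close>)
qed

lemma eval_0: "eval x 0 = coord x 0"
proof -
  have "(\<lambda>n. coord x n * 0 ^ n) sums coord x 0" by (rule powser_sums_zero)
  then show ?thesis using eval_sums[of 0 x] sums_unique2 by simp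
qed

lemma s2_fun_0: "s2_fun x 0 = coord x 0"
  by (simp add: s2_fun_def eval_0 coord_integ)

lemma s2_fun_in_S2 [simp]: "s2_fun x \<in> S2"
  by (rule S2I_eval_deriv) (auto intro: s2_fun_has_field_derivative simp: s2_fun_def)

lemma l2_eqI_unshift:
  assumes "coord x 0 = coord y 0" "unshift x = unshift y" shows "x = y"
proof (rule l2_eqI)
  show "coord x n = coord y n" for n
    using assms(1) arg_cong[OF assms(2), of "\<lambda>u. coord u (n - 1)"] by (cases n) auto
qed

lemma s2_seq_fun [simp]: "s2_seq (s2_fun x) = x"
proof (rule l2_eqI_unshift)
  show "coord (s2_seq (s2_fun x)) 0 = coord x 0" by (simp add: coord_s2_seq s2_fun_0)
  show "unshift (s2_seq (s2_fun x)) = unshift x"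
    by (rule S2I_eval_deriv) (auto intro: s2_fun_has_field_derivative simp: s2_fun_def)
qed

text \<open>Both functions have the same derivative on the disc and the same value at 0; off the
  disc they vanish by the choice of representatives.\<close>

lemma s2_fun_seq:
  assumes f: "f \<in> S2" shows "s2_fun (s2_seq f) = f"
proof
  fix z
  define h where "h w = s2_fun (s2_seq f) w - f w" for w
  have "(h has_field_derivative 0) (at w within ball 0 1)" if "w \<in> ball 0 1" for w
    using DERIV_diff[OF s2_fun_has_field_derivative[of w "s2_seq f"] S2_has_field_derivative[OF f, of w]] that
    unfolding h_def by (auto intro: has_field_derivative_at_within)
  then obtain c where c: "\<And>w. w \<in> ball 0 1 \<Longrightarrow> h w = c"
    using has_field_derivative_zero_constant[OF convex_ball, of 0 1 h] by blast
  have "h 0 = 0" by (simp add: h_def s2_fun_0 coord_s2_seq[OF f])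
  then have "h w = 0" if "w \<in> ball 0 1" for w using c[OF that] c[of 0] by simp
  then show "s2_fun (s2_seq f) z = f z"
    using f by (cases "cmod z < 1") (auto simp: h_def s2_fun_def S2_def)
qed

lemma S2_eq_range: "S2 = range s2_fun"
proof (intro equalityI subsetI)
  show "f \<in> range s2_fun" if "f \<in> S2" for f
    using rangeI[of s2_fun "s2_seq f"] by (simp add: s2_fun_seq[OF that])
qed auto

lemma inj_s2_fun: "s2_fun x = s2_fun y \<longleftrightarrow> x = y"
  by (metis s2_seq_fun)

lemma s2_fun_add: "s2_fun (x + y) = (\<lambda>z. s2_fun x z + s2_fun y z)"
  and s2_fun_diff: "s2_fun (x - y) = (\<lambda>z. s2_fun x z - s2_fun y z)"
  and s2_fun_cscale: "s2_fun (c *\<^sub>C x) = (\<lambda>z. c * s2_fun x z)"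
  and s2_fun_zero: "s2_fun 0 = (\<lambda>z. 0)"
  by (simp_all add: fun_eq_iff s2_fun_def clinear_bddD[OF clinear_bdd_integ]) (simp add: eval_def)

lemma s2_inner_fun: "s2_inner (s2_fun x) (s2_fun y) = cinner x y"
proof -
  have "cinner x y = (\<Sum>n. coord x (Suc n) * cnj (coord y (Suc n))) + coord x 0 * cnj (coord y 0)"
    unfolding cinner_def using suminf_split_head[OF summable_cinner[of x y]] by simp
  then show ?thesis
    unfolding s2_inner_def by (simp add: s2_fun_0 flip: coord_s2_seq(2)[OF s2_fun_in_S2])
qed

lemma s2_norm_fun: "s2_norm (s2_fun x) = norm x"
proof -
  have "(norm x)\<^sup>2 = (\<Sum>n. (cmod (coord x (Suc n)))\<^sup>2) + (cmod (coord x 0))\<^sup>2"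
    unfolding norm_l2_sq using suminf_split_head[OF summable_coord_sq[of x]] by simp
  then show ?thesis
    unfolding s2_norm_def
    by (simp add: s2_fun_0 real_sqrt_unique add.commute flip: coord_s2_seq(2)[OF s2_fun_in_S2])
qed

section \<open>Operators on \<open>S2\<close> in coordinates\<close>

lemma s2_bounded_opI:
  assumes A: "clinear_bdd A" and T: "\<And>x. T (s2_fun x) = s2_fun (A x)"
  shows "s2_bounded_op T"
proof -
  obtain K where "\<forall>x. norm (A x) \<le> K * norm x" using clinear_bdd_pos_bound[OF A] by blast
  then show ?thesis
    unfolding s2_bounded_op_def lin_on_def S2_eq_range
    by (auto simp: T s2_norm_fun clinear_bddD[OF A] s2_fun_add s2_fun_cscale
        simp flip: s2_fun_add s2_fun_cscale)
qed

lemma s2_bounded_opE: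
  assumes T: "s2_bounded_op T"
  obtains A where "clinear_bdd A" "\<And>x. T (s2_fun x) = s2_fun (A x)"
proof -
  define A where "A x = s2_seq (T (s2_fun x))" for x
  have TA: "T (s2_fun x) = s2_fun (A x)" for x
    using T unfolding A_def s2_bounded_op_def by (subst s2_fun_seq) auto
  obtain K where K: "\<And>f. f \<in> S2 \<Longrightarrow> s2_norm (T f) \<le> K * s2_norm f"
    using T unfolding s2_bounded_op_def by blast
  have lin: "lin_on S2 T" using T unfolding s2_bounded_op_def by blast
  have "clinear_bdd A"
  proof (rule clinear_bddI[of _ K])
    fix x y c
    have "s2_fun (A (x + y)) = s2_fun (A x + A y)"
      using lin unfolding lin_on_def by (simp add: s2_fun_add flip: TA)
    then show "A (x + y) = A x + A y" by (simp only: inj_s2_fun)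
    have "s2_fun (A (c *\<^sub>C x)) = s2_fun (c *\<^sub>C A x)"
      using lin unfolding lin_on_def by (simp add: s2_fun_cscale flip: TA)
    then show "A (c *\<^sub>C x) = c *\<^sub>C A x" by (simp only: inj_s2_fun)
    show "norm (A x) \<le> K * norm x"
      using K[of "s2_fun x"] by (simp add: TA s2_norm_fun)
  qed
  then show thesis using TA by (rule that)
qed

text \<open>The definite description has exactly one solution: on \<open>S2\<close> it is determined
  by \<open>cinner_eqI\<close>, elsewhere by the prescribed value 0.\<close>

lemma s2_adjoint_fun:
  assumes T: "\<And>x. T (s2_fun x) = s2_fun (A x)" and adj: "\<And>x y. cinner (A x) y = cinner x (As y)"
  shows "s2_adjoint T (s2_fun y) = s2_fun (As y)"
proof -
  define B where "B g = (if g \<in> S2 then s2_fun (As (s2_seq g)) else (\<lambda>z. 0))" for g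
  have "s2_adjoint T = B"
    unfolding s2_adjoint_def
  proof (rule the_equality)
    show "(\<forall>g. g \<notin> S2 \<longrightarrow> B g = (\<lambda>z. 0)) \<and> (\<forall>g\<in>S2. B g \<in> S2) \<and>
      (\<forall>f\<in>S2. \<forall>g\<in>S2. s2_inner (T f) g = s2_inner f (B g))"
      by (auto simp: B_def S2_eq_range T s2_inner_fun adj)
    fix B'
    assume B': "(\<forall>g. g \<notin> S2 \<longrightarrow> B' g = (\<lambda>z. 0)) \<and> (\<forall>g\<in>S2. B' g \<in> S2) \<and>
      (\<forall>f\<in>S2. \<forall>g\<in>S2. s2_inner (T f) g = s2_inner f (B' g))"
    have "B' (s2_fun y) = B (s2_fun y)" for y
    proof -
      obtain y' where y': "B' (s2_fun y) = s2_fun y'" using B' S2_eq_range by fastforce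
      have "cinner x y' = cinner x (As y)" for x
      proof -
        have "s2_inner (T (s2_fun x)) (s2_fun y) = s2_inner (s2_fun x) (B' (s2_fun y))"
          using B' by simp
        then show ?thesis by (simp add: y' T s2_inner_fun adj)
      qed
      then have "y' = As y" by (rule cinner_eqI)
      then show ?thesis by (simp add: y' B_def)
    qed
    note on_S2 = this
    show "B' = B"
    proof
      show "B' g = B g" for g
      proof (cases "g \<in> S2")
        case True
        then show ?thesis using on_S2[of "s2_seq g"] by (simp add: s2_fun_seq)
      next
        case False
        then show ?thesis using B' by (simp add: B_def)
      qed
    qed
  qed
  then show ?thesis by (simp add: B_def)
qed

lemma comp_op_coordinates:
  fixes r :: real
  assumes r: "\<bar>r\<bar> < 1" and W: "clinear_bdd W"
    and evW: "\<And>x (z::complex). cmod z < 1 \<Longrightarrow> eval (W x) z = (1 - r\<^sup>2) / (1 + r * z)\<^sup>2 * eval x (phi r z)"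
  obtains C where "clinear_bdd C" "\<And>x. comp_op r (s2_fun x) = s2_fun (C x)"
    "\<And>x. unshift (C x) = W (unshift x)"
proof -
  define C where "C x = s2_seq (comp_op r (s2_fun x))" for x
  have der: "(comp_op r (s2_fun x) has_field_derivative eval (W (unshift x)) z) (at z)" if z: "cmod z < 1" for x z
  proof -
    have nz: "1 + r * z \<noteq> 0" by (rule one_plus_rz_nonzero[OF r z])
    have "(phi r has_field_derivative (1 - r\<^sup>2) / (1 + r * z)\<^sup>2) (at z)"
      unfolding phi_def using nz
      by (auto intro!: derivative_eq_intros simp: power2_eq_square field_simps)
    then have "((\<lambda>w. s2_fun x (phi r w)) has_field_derivative
        eval (unshift x) (phi r z) * ((1 - r\<^sup>2) / (1 + r * z)\<^sup>2)) (at z)"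
      by (rule DERIV_chain2[where g = "phi r", OF s2_fun_has_field_derivative[OF cmod_phi_less_1[OF r z]]])
    then have "((\<lambda>w. s2_fun x (phi r w)) has_field_derivative eval (W (unshift x)) z) (at z)"
      by (simp add: evW[OF z] mult.commute)
    then show ?thesis
      by (rule has_field_derivative_transform_within_open[of _ _ _ "ball 0 1"])
        (use z in \<open>auto simp: comp_op_def\<close>)
  qed
  have outside: "comp_op r f z = 0" if "\<not> cmod z < 1" for f z using that by (simp add: comp_op_def)
  have S2: "comp_op r (s2_fun x) \<in> S2" and un: "unshift (C x) = W (unshift x)" for x
    unfolding C_def using S2I_eval_deriv[OF outside der] by blast+
  have C0: "coord (C x) 0 = eval (integ x) r" for x
    unfolding C_def coord_s2_seq(1)[OF S2] using r by (simp add: comp_op_def phi_def s2_fun_def)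
  \<comment> \<open>This decomposition gives boundedness: the value of the composition at 0 is f(r),
    a bounded functional of f, and the derivative part is \<open>W\<close> between the two
    shifts.\<close>
  have C: "C x = cinner (integ x) (kern r) *\<^sub>C unit_vec 0 + shift (W (unshift x))" for x
    using shift_unshift[of "C x"] by (simp add: un C0 eval_def)
  have "clinear_bdd (\<lambda>x. cinner x (kern r) *\<^sub>C unit_vec 0)"
  proof (rule clinear_bddI[of _ "norm (kern r) * norm (unit_vec 0)"])
    fix x y c
    show "cinner (x + y) (kern r) *\<^sub>C unit_vec 0 = cinner x (kern r) *\<^sub>C unit_vec 0 + cinner y (kern r) *\<^sub>C unit_vec 0"
      "cinner (c *\<^sub>C x) (kern r) *\<^sub>C unit_vec 0 = c *\<^sub>C cinner x (kern r) *\<^sub>C unit_vec 0"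
      by (simp_all add: cinner_simps cscale_distribs)
    show "norm (cinner x (kern r) *\<^sub>C unit_vec 0) \<le> norm (kern r) * norm (unit_vec 0) * norm x"
      using mult_right_mono[OF cmod_cinner_le[of x "kern r"], of "norm (unit_vec 0)"] by (simp add: mult_ac)
  qed
  from clinear_bdd_compose[OF this clinear_bdd_integ]
  have "clinear_bdd C"
    unfolding C[abs_def]
    by (intro clinear_bdd_add clinear_bdd_compose[OF clinear_bdd_shift]
        clinear_bdd_compose[OF W] clinear_bdd_unshift)
  then show thesis
    by (rule that) (simp_all add: un, simp add: C_def s2_fun_seq[OF S2])
qed

text \<open>M is the image of \<open>X\<close>, and J is its inverse. The lower bound makes M closed
  and J bounded; the intertwining relation gives both the invariance of M and the
  similarity.\<close>

lemma s2_universalI: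
  assumes U': "clinear_bdd U'" and U: "\<And>x. U (s2_fun x) = s2_fun (U' x)"
    and ex: "\<And>T. clinear_bdd T \<Longrightarrow> \<exists>X c. clinear_bdd X \<and> c \<noteq> 0 \<and> (\<forall>x. norm x \<le> norm (X x))
        \<and> (\<forall>x. U' (X x) = c *\<^sub>C X (T x))"
  shows "s2_universal U"
  unfolding s2_universal_def
proof (intro conjI allI impI)
  show "s2_bounded_op U" by (rule s2_bounded_opI[OF U' U])
  fix T assume "s2_bounded_op T"
  then obtain T' where T': "clinear_bdd T'" "\<And>x. T (s2_fun x) = s2_fun (T' x)"
    using s2_bounded_opE by blast
  obtain X c where X: "clinear_bdd X" "c \<noteq> 0" "\<And>x. norm x \<le> norm (X x)"
    "\<And>x. U' (X x) = c *\<^sub>C X (T' x)" using ex[OF T'(1)] by blast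
  note XL = clinear_bddD[OF X(1)]
  obtain K where K: "K > 0" "\<And>x. norm (X x) \<le> K * norm x"
    using clinear_bdd_pos_bound[OF X(1)] by auto
  have inj: "X x = X y \<longleftrightarrow> x = y" for x y
    using X(3)[of "x - y"] by (auto simp: XL)
  define M where "M = range (\<lambda>x. s2_fun (X x))"
  define J where "J f = s2_fun (inv X (s2_seq f))" for f
  have J: "J (s2_fun (X x)) = s2_fun x" for x
    unfolding J_def s2_seq_fun by (subst inv_f_f) (simp_all add: inj inj_def)
  have cX: "s2_fun (X x) = s2_fun (X y) \<longleftrightarrow> x = y" for x y by (simp add: inj_s2_fun inj)
  have "s2_closed_subspace M"
    unfolding s2_closed_subspace_def
  proof (intro conjI ballI allI impI)
    show "M \<subseteq> S2" by (auto simp: M_def)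
    show "(\<lambda>z. 0) \<in> M" unfolding M_def
      by (rule image_eqI[of _ _ 0]) (simp_all add: XL s2_fun_zero)
    show "(\<lambda>z. f z + g z) \<in> M" if fg: "f \<in> M" "g \<in> M" for f g
    proof -
      obtain x y where "f = s2_fun (X x)" "g = s2_fun (X y)" using fg unfolding M_def by blast
      then have "(\<lambda>z. f z + g z) = s2_fun (X (x + y))" by (simp add: XL s2_fun_add)
      then show ?thesis by (auto simp: M_def)
    qed
    show "(\<lambda>z. c * f z) \<in> M" if fg: "f \<in> M" for c f
    proof -
      obtain x where "f = s2_fun (X x)" using fg unfolding M_def by blast
      then have "(\<lambda>z. c * f z) = s2_fun (X (c *\<^sub>C x))" by (simp add: XL s2_fun_cscale)
      then show ?thesis by (auto simp: M_def)
    qed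
    fix F f
    assume F: "(\<forall>n. F n \<in> M) \<and> f \<in> S2 \<and> (\<lambda>n. s2_norm (\<lambda>z. F n z - f z)) \<longlonglongrightarrow> 0"
    then have "\<forall>n. \<exists>x. F n = s2_fun (X x)" unfolding M_def by blast
    then obtain x where x: "\<And>n. F n = s2_fun (X (x n))" by metis
    obtain y where y: "f = s2_fun y" using F S2_eq_range by blast
    have "s2_norm (\<lambda>z. F n z - f z) = norm (X (x n) - y)" for n
      unfolding x y by (simp flip: s2_fun_diff add: s2_norm_fun)
    then have lim: "(\<lambda>n. X (x n)) \<longlonglongrightarrow> y" using F by (simp add: LIM_zero_iff tendsto_norm_zero_iff)
    have "Cauchy x"
    proof (rule metric_CauchyI)
      fix e :: real assume "e > 0"
      then obtain N where N: "\<And>m n. m \<ge> N \<Longrightarrow> n \<ge> N \<Longrightarrow> dist (X (x m)) (X (x n)) < e"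
        using LIMSEQ_imp_Cauchy[OF lim] metric_CauchyD by blast
      have "dist (x m) (x n) < e" if "m \<ge> N" "n \<ge> N" for m n
        using X(3)[of "x m - x n"] N[OF that] by (simp add: dist_norm XL)
      then show "\<exists>N. \<forall>m\<ge>N. \<forall>n\<ge>N. dist (x m) (x n) < e" by blast
    qed
    then obtain x0 where "x \<longlonglongrightarrow> x0" by (auto simp: Cauchy_convergent_iff convergent_def)
    then have "(\<lambda>n. X (x n)) \<longlonglongrightarrow> X x0" by (rule bounded_linear.tendsto[OF XL(1)])
    then have "y = X x0" using lim LIMSEQ_unique by blast
    then show "f \<in> M" by (simp add: y M_def)
  qed
  moreover have "\<forall>m\<in>M. U m \<in> M"
  proof -
    have "U (s2_fun (X x)) = s2_fun (X (c *\<^sub>C T' x))" for x by (simp add: U X(4) XL)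
    then show ?thesis by (auto simp: M_def)
  qed
  moreover have "s2_similar_restr U M (\<lambda>f z. c * T f z)"
    unfolding s2_similar_restr_def
  proof (intro exI[of _ J] conjI)
    show "bij_betw J M S2"
      unfolding bij_betw_def
    proof
      show "inj_on J M" by (auto simp: inj_on_def M_def J inj_s2_fun)
      show "J ` M = S2" unfolding S2_eq_range M_def by (auto simp: J image_image)
    qed
    show "lin_on M J"
      unfolding lin_on_def M_def
    proof (intro conjI ballI allI)
      fix f g c assume f: "f \<in> range (\<lambda>x. s2_fun (X x))"
      then obtain x where x: "f = s2_fun (X x)" by blast
      have "(\<lambda>z. c * f z) = s2_fun (X (c *\<^sub>C x))" by (simp add: x XL s2_fun_cscale)
      then show "J (\<lambda>z. c * f z) = (\<lambda>z. c * J f z)" by (simp add: x J s2_fun_cscale)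
      assume "g \<in> range (\<lambda>x. s2_fun (X x))"
      then obtain y where y: "g = s2_fun (X y)" by blast
      have "(\<lambda>z. f z + g z) = s2_fun (X (x + y))" by (simp add: x y XL s2_fun_add)
      then show "J (\<lambda>z. f z + g z) = (\<lambda>z. J f z + J g z)" by (simp add: x y J s2_fun_add)
    qed
    show "\<exists>K. \<forall>m\<in>M. s2_norm (J m) \<le> K * s2_norm m"
      by (rule exI[of _ 1]) (auto simp: M_def J s2_norm_fun X(3))
    show "\<exists>K. \<forall>m\<in>M. s2_norm m \<le> K * s2_norm (J m)"
      by (rule exI[of _ K]) (auto simp: M_def J s2_norm_fun K(2))
    show "\<forall>m\<in>M. J (U m) = (\<lambda>z. c * T (J m) z)"
    proof
      fix m assume "m \<in> M"
      then obtain x where m: "m = s2_fun (X x)" unfolding M_def by blast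
      have "U m = s2_fun (X (c *\<^sub>C T' x))" by (simp add: m U X(4) XL)
      then show "J (U m) = (\<lambda>z. c * T (J m) z)" by (simp add: m J T'(2) s2_fun_cscale)
    qed
  qed
  ultimately show "\<exists>M c. s2_closed_subspace M \<and> (\<forall>m\<in>M. U m \<in> M) \<and> c \<noteq> 0 \<and>
      s2_similar_restr U M (\<lambda>f z. c * T f z)" using X(2) by blast
qed

section \<open>Universality\<close>

text \<open>The functions vanishing at 0 are those of the form \<open>s2_fun (shift x)\<close>; they form a subspace
  invariant under the adjoint of the composition operator, which acts there as the adjoint of W.
  Working inside this subspace covers \<open>\<lambda> = 1\<close>, where \<open>C\<^sub>\<phi> - \<lambda>\<close> kills the constants.\<close>

theorem theorem3p2:
  fixes r :: real and lam :: complex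
  assumes "0 < r" and "r < 1"
    and "sqrt ((1 - r) / (1 + r)) < cmod lam"
    and "cmod lam < 1 / sqrt ((1 - r) / (1 + r))"
  shows "s2_universal (\<lambda>f. (\<lambda>z. s2_adjoint (comp_op r) f z - cnj lam * f z))"
proof -
  define a where "a = (1 - r) / (1 + r)"
  have a: "0 < a" "a < 1" using assms(1,2) by (auto simp: a_def)
  have lam: "sqrt a < cmod lam" "cmod lam < 1 / sqrt a" using assms(3,4) by (auto simp: a_def)
  have r: "\<bar>r\<bar> < 1" and r2: "1 - r\<^sup>2 > 0" using assms(1,2) by (auto simp: power_less_one_iff)
  obtain k where k: "clinear_bdd k"
    "\<And>x (z::complex). cmod z < 1 \<Longrightarrow>
      eval (k x) z = sqrt (1 - r\<^sup>2) / (1 + r * z)\<^sup>2 * eval x (phi r z)"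
    "\<And>x y. cinner (k x + r *\<^sub>C shift (k x)) (k y + r *\<^sub>C shift (k y)) = cinner x y"
    "\<And>x y. cinner (shift (k x) + r *\<^sub>C k x) (k y + r *\<^sub>C shift (k y)) = cinner (shift x) y"
    using weighted_composition_exists[OF r] by blast
  define W where "W x = sqrt (1 - r\<^sup>2) *\<^sub>C k x" for x
  have W: "clinear_bdd W" unfolding W_def by (rule clinear_bdd_cscale[OF k(1)])
  have evW: "eval (W x) z = (1 - r\<^sup>2) / (1 + r * z)\<^sup>2 * eval x (phi r z)" if "cmod z < 1" for x and z :: complex
  proof -
    have "complex_of_real (sqrt (1 - r\<^sup>2)) * sqrt (1 - r\<^sup>2) = of_real (1 - r\<^sup>2)"
      using r2 unfolding of_real_mult[symmetric] by simp
    then show ?thesis using that by (simp add: W_def k(2) flip: mult.assoc)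
  qed
  obtain Ws where Ws: "clinear_bdd Ws" "\<And>x y. cinner (W x) y = cinner x (Ws y)"
    using adjoint_exists[OF W] by blast
  have "(sqrt a)\<^sup>2 < (cmod lam)\<^sup>2" using lam a by (intro power_strict_mono) auto
  moreover have "(cmod lam)\<^sup>2 < (1 / sqrt a)\<^sup>2" using lam by (intro power_strict_mono) auto
  ultimately have lam2: "(1 - r) / (1 + r) < (cmod lam)\<^sup>2" "(cmod lam)\<^sup>2 < (1 + r) / (1 - r)"
    using a by (simp_all add: a_def power_divide)
  obtain d where d: "d > 0" "\<And>x. d * norm x \<le> norm (W x - lam *\<^sub>C x)"
    using weighted_composition_minus_bounded_below[OF assms(1,2) k(1,3,4) lam2] unfolding W_def by metis
  define B where "B x = W x - lam *\<^sub>C x" for x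
  define Bs where "Bs x = Ws x - cnj lam *\<^sub>C x" for x
  have B: "clinear_bdd B" and Bs: "clinear_bdd Bs"
    unfolding B_def Bs_def by (intro clinear_bdd_diff clinear_bdd_cscale clinear_bdd_id W Ws)+
  have adj: "cinner (B x) y = cinner x (Bs y)" for x y
    by (simp add: B_def Bs_def cinner_simps Ws(2))
  define S where "S = {x. Bs x = 0}"
  have "Bs (orbit_sum a lam w) = 0" if "w > 0" for w
    unfolding Bs_def using adjoint_orbit_kern[OF assms(1,2) evW Ws(2,1)]
    by (subst adjoint_orbit_sum[OF a(1) lam that Ws(1)]) (auto simp: a_def)
  then have S_inf: "\<nexists>G. finite G \<and> S \<subseteq> span G"
    by (intro orbit_sums_infinite_dim[OF a lam]) (simp add: S_def)
  have S_sub: "subspace S"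
    unfolding S_def subspace_def by (simp add: clinear_bddD[OF Bs] scaleR_cscale)
  obtain u :: "nat \<Rightarrow> l2"
    where u: "\<And>n. u n \<in> S" "\<And>m n. cinner (u m) (u n) = (if m = n then 1 else 0)"
    using infinite_dim_orthonormal_sequence[OF S_sub S_inf] by blast
  obtain V where V: "clinear_bdd V" "\<And>x. (\<lambda>n. coord x n *\<^sub>C u n) sums V x"
    "\<And>x y. cinner (V x) (V y) = cinner x y"
    using orthonormal_synthesis[OF u(2)] by blast
  have BsV: "Bs (V x) = 0" for x
  proof -
    have "(\<lambda>n. Bs (coord x n *\<^sub>C u n)) sums Bs (V x)"
      by (rule bounded_linear.sums[OF clinear_bddD(1)[OF Bs] V(2)])
    moreover have "Bs (coord x n *\<^sub>C u n) = 0" for n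
      using u(1)[of n] by (simp add: S_def clinear_bddD(2)[OF Bs])
    ultimately have "(\<lambda>n. 0) sums Bs (V x)" by simp
    then show ?thesis by (rule sums_unique2[OF _ sums_zero])
  qed
  obtain C where C: "clinear_bdd C" "\<And>x. comp_op r (s2_fun x) = s2_fun (C x)"
    "\<And>x. unshift (C x) = W (unshift x)"
    using comp_op_coordinates[OF r W evW] by blast
  obtain Cs where Cs: "clinear_bdd Cs" "\<And>x y. cinner (C x) y = cinner x (Cs y)"
    using adjoint_exists[OF C(1)] by blast
  \<comment> \<open>The adjoint form of \<open>unshift (C x) = W (unshift x)\<close>, as
    \<open>shift\<close> is the adjoint of \<open>unshift\<close>.\<close>
  have Cs_shift: "Cs (shift y) = shift (Ws y)" for y
    by (rule cinner_eqI) (simp add: Cs(2)[symmetric] Ws(2)[symmetric] cinner_shift_right C(3))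
  show ?thesis
  proof (rule s2_universalI[of "\<lambda>x. Cs x - cnj lam *\<^sub>C x"])
    show "clinear_bdd (\<lambda>x. Cs x - cnj lam *\<^sub>C x)"
      by (intro clinear_bdd_diff clinear_bdd_cscale clinear_bdd_id Cs)
    show "(\<lambda>z. s2_adjoint (comp_op r) (s2_fun x) z - cnj lam * s2_fun x z)
        = s2_fun (Cs x - cnj lam *\<^sub>C x)" for x
      unfolding s2_adjoint_fun[OF C(2) Cs(2)] by (simp add: s2_fun_diff s2_fun_cscale)
    fix T assume "clinear_bdd T"
    then obtain X c where X: "clinear_bdd X" "c \<noteq> 0" "\<And>x. norm x \<le> norm (X x)"
      "\<And>x. Bs (X x) = c *\<^sub>C X (T x)"
      using caradus[OF B Bs adj d(2)[folded B_def] d(1) V(1,3) BsV] by blast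
    \<comment> \<open>The isometry \<open>shift\<close> carries the solution found for W over to the
      functions vanishing at 0.\<close>
    have "Cs (shift (X x)) - cnj lam *\<^sub>C shift (X x) = c *\<^sub>C shift (X (T x))" for x
      unfolding Cs_shift using X(4)[of x] unfolding Bs_def
      by (simp flip: clinear_bddD(2,4)[OF clinear_bdd_shift])
    moreover have "clinear_bdd (\<lambda>x. shift (X x))" by (rule clinear_bdd_compose[OF clinear_bdd_shift X(1)])
    ultimately show "\<exists>X c. clinear_bdd X \<and> c \<noteq> 0 \<and> (\<forall>x. norm x \<le> norm (X x)) \<and>
        (\<forall>x. Cs (X x) - cnj lam *\<^sub>C X x = c *\<^sub>C X (T x))"
      using X(2,3) by (intro exI[of _ "\<lambda>x. shift (X x)"] exI[of _ c]) auto
  qed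
qed

end
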